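(* For a quadrilateral made of lines of curvature of a triaxial ellipsoid $\frac{x^2}{a}+\frac{y^2}{b}+\frac{z^2}{c}=1$ ($a>b>c>0$) in $\mathbb{R}^3$, the two pairs of opposite vertices are at equal geodesic distances.
   Context: The lines of curvature of the ellipsoid are its curves of intersection with the other quadrics of the confocal family $\frac{x^2}{a-\lambda}+\frac{y^2}{b-\lambda}+\frac{z^2}{c-\lambda}=1$. Away from the four umbilical points they form an orthogonal net consisting of two families of curves. A quadrilateral made of lines of curvature is a curvilinear quadrilateral on the ellipsoid whose one pair of opposite sides are arcs of lines of curvature of one family and whose other pair of opposite sides are arcs of lines of curvature of the other family. Geodesic distances are those of the intrinsic metric of the ellipsoid.
   Formalization: The quadrilateral is taken to be an embedded curvilinear square that contains no umbilical point, in its interior or on its boundary; a quadrilateral of four such arcs going around one umbilical point can have unequal geodesic distances between opposite vertices. *)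

theory Defs
  imports "HOL-Analysis.Analysis"
begin

definition ellipsoid :: "real \<Rightarrow> real \<Rightarrow> real \<Rightarrow> (real^3) set" where
  "ellipsoid a b c = {p. (p$1)\<^sup>2 / a + (p$2)\<^sup>2 / b + (p$3)\<^sup>2 / c = 1}"

(* The equation of the confocal quadric with its denominators cleared. For l = a, b, c this gives
   the coordinate plane that is the limit of the family; the three principal sections of the
   ellipsoid are thereby among its lines of curvature. *)
definition confocal_quadric :: "real \<Rightarrow> real \<Rightarrow> real \<Rightarrow> real \<Rightarrow> (real^3) set" where
  "confocal_quadric a b c l =
     {p. (p$1)\<^sup>2 * (b - l) * (c - l) + (p$2)\<^sup>2 * (a - l) * (c - l) + (p$3)\<^sup>2 * (a - l) * (b - l)
         = (a - l) * (b - l) * (c - l)}"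

lemma confocal_quadric_generic:
  assumes "l \<noteq> a" "l \<noteq> b" "l \<noteq> c"
  shows "confocal_quadric a b c l =
           {p. (p$1)\<^sup>2 / (a - l) + (p$2)\<^sup>2 / (b - l) + (p$3)\<^sup>2 / (c - l) = 1}"
proof -
  have "x * B * C + y * A * C + z * A * B = A * B * C \<longleftrightarrow> x / A + y / B + z / C = 1"
    if "A \<noteq> 0" "B \<noteq> 0" "C \<noteq> 0" for x y z A B C :: real
    using that by (simp add: divide_simps) (simp add: algebra_simps)
  from this[of "a - l" "b - l" "c - l"] show ?thesis
    using assms by (simp add: confocal_quadric_def)
qed

lemma confocal_quadric_degenerate:
  assumes "a > b" "b > c"
  shows "confocal_quadric a b c a = {p. p$1 = 0}"
    and "confocal_quadric a b c b = {p. p$2 = 0}"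
    and "confocal_quadric a b c c = {p. p$3 = 0}"
  using assms by (auto simp: confocal_quadric_def)

(* Umbilical point: on the tangent plane the second fundamental form is a multiple of the first.
   Up to a scalar factor depending only on p, the second fundamental form of the ellipsoid is the
   Hessian of x^2/a + y^2/b + z^2/c restricted to the tangent plane. *)
definition umbilics :: "real \<Rightarrow> real \<Rightarrow> real \<Rightarrow> (real^3) set" where
  "umbilics a b c =
     {p \<in> ellipsoid a b c. \<exists>k. \<forall>v::real^3.
        p$1 * v$1 / a + p$2 * v$2 / b + p$3 * v$3 / c = 0 \<longrightarrow>
        (v$1)\<^sup>2 / a + (v$2)\<^sup>2 / b + (v$3)\<^sup>2 / c = k * (norm v)\<^sup>2}"

(* For p on the ellipsoid the quadrics through p have parameters 0, l, m with c <= l <= b <= m <= a,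
   and l = m only at the umbilical points. The first family consists of the curves of constant l,
   the second of the curves of constant m. The condition on the other parameter matters only when
   the fixed one is b: the section y = 0 is cut by the umbilical points into four arcs, two of
   each family. *)
definition curvature_line1 :: "real \<Rightarrow> real \<Rightarrow> real \<Rightarrow> real \<Rightarrow> (real^3) set" where
  "curvature_line1 a b c l =
     {p \<in> ellipsoid a b c - umbilics a b c.
        p \<in> confocal_quadric a b c l \<and> (\<exists>m\<in>{b..a}. m \<noteq> l \<and> p \<in> confocal_quadric a b c m)}"

definition curvature_line2 :: "real \<Rightarrow> real \<Rightarrow> real \<Rightarrow> real \<Rightarrow> (real^3) set" where
  "curvature_line2 a b c m =
     {p \<in> ellipsoid a b c - umbilics a b c.
        p \<in> confocal_quadric a b c m \<and> (\<exists>l\<in>{c..b}. l \<noteq> m \<and> p \<in> confocal_quadric a b c l)}"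

(* A curvilinear quadrilateral is an embedded square: its sides are the images of the four edges and
   its vertices the images of the four corners. It lies in the part of the ellipsoid where the
   lines of curvature form a net. This condition is needed on the interior too: a closed curve made
   of four such arcs but going around an umbilical point can have unequal diagonals. *)
definition curvature_quadrilateral ::
    "real \<Rightarrow> real \<Rightarrow> real \<Rightarrow> (real \<times> real \<Rightarrow> real^3) \<Rightarrow> bool" where
  "curvature_quadrilateral a b c f \<longleftrightarrow>
     continuous_on ({0..1} \<times> {0..1}) f \<and> inj_on f ({0..1} \<times> {0..1}) \<and>
     f ` ({0..1} \<times> {0..1}) \<subseteq> ellipsoid a b c - umbilics a b c \<and>
     (\<forall>t\<in>{0, 1}. \<exists>l\<in>{c..b}. f ` ({0..1} \<times> {t}) \<subseteq> curvature_line1 a b c l) \<and>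
     (\<forall>s\<in>{0, 1}. \<exists>m\<in>{b..a}. f ` ({s} \<times> {0..1}) \<subseteq> curvature_line2 a b c m)"

(* The derivative of a valid_path may be unbounded near the exceptional points, so the speed need
   not be integrable; has_integral leaves out such paths of infinite length. *)
definition intrinsic_dist :: "(real^3) set \<Rightarrow> real^3 \<Rightarrow> real^3 \<Rightarrow> real" where
  "intrinsic_dist S p q =
     Inf {L. \<exists>g. valid_path g \<and> path_image g \<subseteq> S \<and> pathstart g = p \<and> pathfinish g = q \<and>
               ((\<lambda>t. norm (vector_derivative g (at t))) has_integral L) {0..1}}"

end

theory Submission
  imports Defs
begin

text \<open>
  In ellipsoidal coordinates the metric is
  \<open>(\<mu>(\<phi>) - \<lambda>(\<psi>)) (E(\<phi>) d\<phi>\<^sup>2 + G(\<psi>) d\<psi>\<^sup>2)\<close>. By the inequality of arithmetic and geometric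
  means the length of a curve is at most the action
  \<open>1/2 \<integral> (\<mu>(\<phi>) + E(\<phi>) \<phi>'\<^sup>2) + (- \<lambda>(\<psi>) + G(\<psi>) \<psi>'\<^sup>2) dt\<close>, and for short arcs away from the umbilical
  points the two agree up to a factor close to 1 if the right duration is chosen. The action is a sum
  of a term in \<open>\<phi>\<close> and a term in \<open>\<psi>\<close>, so running \<open>\<psi>\<close> backwards in time keeps it, while a curve
  from \<open>(\<phi>\<^sub>0, \<psi>\<^sub>0)\<close> to \<open>(\<phi>\<^sub>1, \<psi>\<^sub>1)\<close> becomes one from \<open>(\<phi>\<^sub>0, \<psi>\<^sub>1)\<close> to \<open>(\<phi>\<^sub>1, \<psi>\<^sub>0)\<close>. Hence the infimum
  of the lengths is the same for both diagonals.
\<close>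

section \<open>The action in one variable\<close>

text \<open>No minimising geodesic enters: only infima of lengths are compared. Because the least
  action between nearby points is bounded by (1 + e) times their Euclidean chord, a curve on the
  surface needs only a continuous lift to the chart, not a differentiable one. The obstacle is the
  umbilical points: there \<mu> - \<lambda> vanishes, the chart is branched, and the comparison with
  chords breaks down. What survives is that points close in the chart have small action, and since
  there are finitely many umbilical points this small cost can be paid separately at each one that
  is met. Moreover, time reversal acts on coordinates rather than on points, so it must be
  compatible with the different coordinates of one point; symmetries of the chart ensure this.
  Finally, the vertices need matching coordinates in one common lift, and this is what a square free
  of umbilical points provides.\<close>

definition action_path ::
    "(real \<Rightarrow> real) \<Rightarrow> (real \<Rightarrow> real) \<Rightarrow> real \<Rightarrow> real \<Rightarrow> real \<Rightarrow> real \<Rightarrow> bool" where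
  "action_path V W T x y A \<longleftrightarrow> T > 0 \<and>
     (\<exists>u u' S. finite S \<and> continuous_on {0..T} u \<and>
        (\<forall>t\<in>{0<..<T} - S. (u has_real_derivative u' t) (at t)) \<and>
        continuous_on ({0<..<T} - S) u' \<and> u 0 = x \<and> u T = y \<and>
        ((\<lambda>t. V (u t) + W (u t) * (u' t)\<^sup>2) has_integral A) {0..T})"

lemma action_pathI:
  assumes "T > 0" "finite S" "continuous_on {0..T} u"
    "\<And>t. t \<in> {0<..<T} - S \<Longrightarrow> (u has_real_derivative u' t) (at t)"
    "continuous_on ({0<..<T} - S) u'" "u 0 = x" "u T = y"
    "((\<lambda>t. V (u t) + W (u t) * (u' t)\<^sup>2) has_integral A) {0..T}"
  shows "action_path V W T x y A"
  using assms unfolding action_path_def by blast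

lemma action_pathE:
  assumes "action_path V W T x y A"
  obtains u u' S where "T > 0" "finite S" "continuous_on {0..T} u"
    "\<And>t. t \<in> {0<..<T} - S \<Longrightarrow> (u has_real_derivative u' t) (at t)"
    "continuous_on ({0<..<T} - S) u'" "u 0 = x" "u T = y"
    "((\<lambda>t. V (u t) + W (u t) * (u' t)\<^sup>2) has_integral A) {0..T}"
  using assms unfolding action_path_def by blast

text \<open>The velocity enters squared, so the sign produced by running time backwards
  disappears.\<close>

lemma action_path_reverse:
  assumes "action_path V W T x y A"
  shows "action_path V W T y x A"
  using assms
proof (rule action_pathE)
  fix u u' S
  assume T: "T > 0" and S: "finite S" and cu: "continuous_on {0..T} u"
    and du: "\<And>t. t \<in> {0<..<T} - S \<Longrightarrow> (u has_real_derivative u' t) (at t)"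
    and cu': "continuous_on ({0<..<T} - S) u'" and e: "u 0 = x" "u T = y"
    and I: "((\<lambda>t. V (u t) + W (u t) * (u' t)\<^sup>2) has_integral A) {0..T}"
  let ?r = "\<lambda>t. T - t"
  have mem: "?r t \<in> {0<..<T} - S" if "t \<in> {0<..<T} - ?r ` S" for t
    using that by force
  show ?thesis
  proof (rule action_pathI[where S = "?r ` S" and u = "\<lambda>t. u (T - t)" and u' = "\<lambda>t. - u' (T - t)"])
    show "continuous_on {0..T} (\<lambda>t. u (T - t))"
      by (rule continuous_on_compose2[OF cu]) (auto intro!: continuous_intros)
    show "((\<lambda>t. u (T - t)) has_real_derivative - u' (T - t)) (at t)"
      if "t \<in> {0<..<T} - ?r ` S" for t
      by (rule DERIV_chain2[where f = u and g = "\<lambda>t. T - t" and Db = "-1" and Da = "u' (T - t)", simplified])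
        (use du[OF mem[OF that]] in \<open>auto intro!: derivative_eq_intros\<close>)
    show "continuous_on ({0<..<T} - ?r ` S) (\<lambda>t. - u' (T - t))"
      by (intro continuous_on_minus continuous_on_compose2[OF cu'])
        (use mem in \<open>auto intro!: continuous_intros\<close>)
    have "((\<lambda>t. V (u (- t)) + W (u (- t)) * (u' (- t))\<^sup>2) has_integral A) {-T..0}"
      using has_integral_reflect_real[of "\<lambda>t. V (u t) + W (u t) * (u' t)\<^sup>2" A T 0] I by simp
    from has_integral_affinity'[OF this[folded cbox_interval], of 1 "-T"]
    show "((\<lambda>t. V (u (T - t)) + W (u (T - t)) * (- u' (T - t))\<^sup>2) has_integral A) {0..T}"
      by simp
  qed (use T S e in auto)
qed

text \<open>The corner at \<open>T1\<close> becomes an exceptional time; this is why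
  \<open>action_path\<close> asks for a derivative only off a finite set.\<close>

lemma action_path_join:
  assumes "action_path V W T1 x y A" "action_path V W T2 y z B"
  shows "action_path V W (T1 + T2) x z (A + B)"
proof -
  from assms(1) obtain u u' S where T1: "T1 > 0" and S: "finite S" and cu: "continuous_on {0..T1} u"
    and du: "\<And>t. t \<in> {0<..<T1} - S \<Longrightarrow> (u has_real_derivative u' t) (at t)"
    and cu': "continuous_on ({0<..<T1} - S) u'" and e: "u 0 = x" "u T1 = y"
    and I: "((\<lambda>t. V (u t) + W (u t) * (u' t)\<^sup>2) has_integral A) {0..T1}"
    by (blast elim: action_pathE)
  from assms(2) obtain v v' R where T2: "T2 > 0" and R: "finite R" and cv: "continuous_on {0..T2} v"
    and dv: "\<And>t. t \<in> {0<..<T2} - R \<Longrightarrow> (v has_real_derivative v' t) (at t)"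
    and cv': "continuous_on ({0<..<T2} - R) v'" and e': "v 0 = y" "v T2 = z"
    and J: "((\<lambda>t. V (v t) + W (v t) * (v' t)\<^sup>2) has_integral B) {0..T2}"
    by (blast elim: action_pathE)
  define w where "w = (\<lambda>t. if t \<le> T1 then u t else v (t - T1))"
  define w' where "w' = (\<lambda>t. if t \<le> T1 then u' t else v' (t - T1))"
  define Q where "Q = S \<union> (\<lambda>t. t + T1) ` R \<union> {T1}"
  have sp: "{0<..<T1 + T2} - Q = ({0<..<T1} - Q) \<union> ({T1<..<T1 + T2} - Q)"
    using T1 T2 by (auto simp: Q_def)
  have op: "open ({0<..<T1} - Q)" "open ({T1<..<T1 + T2} - Q)"
    using S R by (auto simp: Q_def intro!: open_Diff finite_imp_closed)
  have m1: "t \<in> {0<..<T1} - S" if "t \<in> {0<..<T1} - Q" for t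
    using that by (auto simp: Q_def)
  have m2: "t - T1 \<in> {0<..<T2} - R" if "t \<in> {T1<..<T1 + T2} - Q" for t
    using that by (force simp: Q_def)
  have w1: "w t = u t" "w' t = u' t" if "t \<in> {0<..<T1} - Q" for t
    using that by (auto simp: w_def w'_def)
  have w2: "w t = v (t - T1)" "w' t = v' (t - T1)" if "t \<in> {T1<..<T1 + T2} - Q" for t
    using that by (auto simp: w_def w'_def)
  show ?thesis
  proof (rule action_pathI[where S = Q and u = w and u' = w'])
    show "continuous_on {0..T1 + T2} w"
    proof -
      have "{0..T1 + T2} = {0..T1} \<union> {T1..T1 + T2}" using T1 T2 by auto
      moreover have "continuous_on ({0..T1} \<union> {T1..T1 + T2}) w"
        unfolding w_def
        by (intro continuous_on_cases continuous_on_compose2[OF cv] cu)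
          (use e e' in \<open>auto intro!: continuous_intros\<close>)
      ultimately show ?thesis by simp
    qed
    show "(w has_real_derivative w' t) (at t)" if "t \<in> {0<..<T1 + T2} - Q" for t
    proof -
      from that sp consider "t \<in> {0<..<T1} - Q" | "t \<in> {T1<..<T1 + T2} - Q" by auto
      then show ?thesis
      proof cases
        case 1
        from has_field_derivative_transform_within_open[OF du[OF m1[OF 1]] op(1) 1] w1
        show ?thesis using 1 by simp
      next
        case 2
        have "((\<lambda>t. v (t - T1)) has_real_derivative v' (t - T1)) (at t)"
          by (rule DERIV_chain2[where f = v and g = "\<lambda>t. t - T1" and Db = 1 and Da = "v' (t - T1)", simplified])
            (use dv[OF m2[OF 2]] in \<open>auto intro!: derivative_eq_intros\<close>)
        from has_field_derivative_transform_within_open[OF this op(2) 2] w2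
        show ?thesis using 2 by simp
      qed
    qed
    show "continuous_on ({0<..<T1 + T2} - Q) w'"
      unfolding sp
    proof (rule continuous_on_open_Un[OF op])
      have "continuous_on ({0<..<T1} - Q) u'"
        using cu' by (rule continuous_on_subset) (use m1 in auto)
      then show "continuous_on ({0<..<T1} - Q) w'"
        by (rule continuous_on_eq) (use w1 in auto)
      have "continuous_on ({T1<..<T1 + T2} - Q) (\<lambda>t. v' (t - T1))"
        by (rule continuous_on_compose2[OF cv']) (use m2 in \<open>auto intro!: continuous_intros\<close>)
      then show "continuous_on ({T1<..<T1 + T2} - Q) w'"
        by (rule continuous_on_eq) (use w2 in auto)
    qed
    show "((\<lambda>t. V (w t) + W (w t) * (w' t)\<^sup>2) has_integral A + B) {0..T1 + T2}"
    proof (rule has_integral_combine[where c = T1])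
      show "((\<lambda>t. V (w t) + W (w t) * (w' t)\<^sup>2) has_integral A) {0..T1}"
        using I by (rule has_integral_eq[rotated]) (auto simp: w_def w'_def)
      have "((\<lambda>t. V (v (t - T1)) + W (v (t - T1)) * (v' (t - T1))\<^sup>2) has_integral B) {T1..T1 + T2}"
        using has_integral_affinity'[OF J[folded cbox_interval], of 1 "-T1"] by (simp add: add.commute)
      then show "((\<lambda>t. V (w t) + W (w t) * (w' t)\<^sup>2) has_integral B) {T1..T1 + T2}"
        by (rule has_integral_spike_finite[where S = "{T1}", rotated 2]) (auto simp: w_def w'_def)
    qed (use T1 T2 in auto)
  qed (use T1 T2 S R e e' in \<open>auto simp: w_def Q_def\<close>)
qed

text \<open>Since s is 1 or -1, the squared velocity is kept. These maps will be the symmetries that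
  relate the different coordinates of one point.\<close>

lemma action_path_isometry:
  assumes "action_path V W T x y A" and s: "s \<in> {1, -1}"
    and inv: "\<And>t. V (s * t + k) = V t" "\<And>t. W (s * t + k) = W t"
  shows "action_path V W T (s * x + k) (s * y + k) A"
  using assms(1)
proof (rule action_pathE)
  fix u u' S
  assume T: "T > 0" and S: "finite S" and cu: "continuous_on {0..T} u"
    and du: "\<And>t. t \<in> {0<..<T} - S \<Longrightarrow> (u has_real_derivative u' t) (at t)"
    and cu': "continuous_on ({0<..<T} - S) u'" and e: "u 0 = x" "u T = y"
    and I: "((\<lambda>t. V (u t) + W (u t) * (u' t)\<^sup>2) has_integral A) {0..T}"
  have s2: "(s * z)\<^sup>2 = z\<^sup>2" for z :: real using s by auto
  show ?thesis
    by (rule action_pathI[where S = S and u = "\<lambda>t. s * u t + k" and u' = "\<lambda>t. s * u' t"])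
      (use T S e I in \<open>auto simp: inv s2 intro!: continuous_intros cu cu' derivative_eq_intros du\<close>)
qed

text \<open>Uniform motion from \<open>x\<close> to \<open>y\<close> in time \<open>T\<close> serves
  as the test path for all upper bounds on the least action.\<close>

lemma action_path_linear:
  fixes V W :: "real \<Rightarrow> real"
  assumes T: "T > 0" and V: "continuous_on UNIV V" and W: "continuous_on UNIV W"
    and bd: "\<And>z. z \<in> closed_segment x y \<Longrightarrow> V z \<le> v \<and> W z \<le> w"
  obtains A where "action_path V W T x y A" "A \<le> T * v + w * (y - x)\<^sup>2 / T"
proof -
  define u where "u = (\<lambda>t. x + t * ((y - x) / T))"
  define F where "F = (\<lambda>t. V (u t) + W (u t) * ((y - x) / T)\<^sup>2)"
  have cu: "continuous_on X u" for X unfolding u_def by (intro continuous_intros)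
  have "continuous_on {0..T} F"
    unfolding F_def by (intro continuous_intros continuous_on_compose2[OF V] continuous_on_compose2[OF W] cu) auto
  then have I: "(F has_integral integral {0..T} F) {0..T}"
    using integrable_continuous_interval by blast
  have "action_path V W T x y (integral {0..T} F)"
    by (rule action_pathI[where S = "{}" and u = u and u' = "\<lambda>_. (y - x) / T"])
      (use T I cu in \<open>auto simp: F_def u_def intro!: derivative_eq_intros\<close>)
  moreover have "integral {0..T} F \<le> T * v + w * (y - x)\<^sup>2 / T"
  proof -
    have "u t \<in> closed_segment x y" if "t \<in> {0..T}" for t
      unfolding in_segment by (rule exI[of _ "t / T"]) (use that T in \<open>auto simp: u_def field_simps\<close>)
    then have "F t \<le> v + w * ((y - x) / T)\<^sup>2" if "t \<in> {0..T}" for t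
      unfolding F_def using bd that by (intro add_mono mult_right_mono) auto
    then have "integral {0..T} F \<le> integral {0..T} (\<lambda>_. v + w * ((y - x) / T)\<^sup>2)"
      using I by (intro integral_le) auto
    also have "\<dots> = T * v + w * (y - x)\<^sup>2 / T"
      using T by (simp add: field_simps power2_eq_square)
    finally show ?thesis .
  qed
  ultimately show ?thesis using that by blast
qed

section \<open>Ellipsoidal coordinates\<close>

definition vec3 :: "real \<Rightarrow> real \<Rightarrow> real \<Rightarrow> real^3" where
  "vec3 x y z = x *\<^sub>R axis 1 1 + y *\<^sub>R axis 2 1 + z *\<^sub>R axis 3 1"

lemma vec3_nth [simp]: "vec3 x y z $ 1 = x" "vec3 x y z $ 2 = y" "vec3 x y z $ 3 = z"
  by (simp_all add: vec3_def axis_def)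

lemma vec3_eqI: "p = vec3 x y z" if "p $ 1 = x" "p $ 2 = y" "p $ 3 = z"
  using that by (simp add: vec_eq_iff forall_3)

lemma norm_vec_3: "(norm p)\<^sup>2 = (p $ 1)\<^sup>2 + (p $ 2)\<^sup>2 + (p $ 3)\<^sup>2" for p :: "real^3"
  unfolding power2_norm_eq_inner inner_vec_def sum_3 by (simp add: power2_eq_square)

lemma continuous_on_vec3 [continuous_intros]:
  assumes "continuous_on S f" "continuous_on S g" "continuous_on S h"
  shows "continuous_on S (\<lambda>t. vec3 (f t) (g t) (h t))"
  unfolding vec3_def by (intro continuous_intros assms)

lemma has_derivative_vec3:
  assumes "(f has_derivative f') F" "(g has_derivative g') F" "(h has_derivative h') F"
  shows "((\<lambda>t. vec3 (f t) (g t) (h t)) has_derivative (\<lambda>t. vec3 (f' t) (g' t) (h' t))) F"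
  unfolding vec3_def by (intro has_derivative_add has_derivative_scaleR_left assms)

locale triaxial =
  fixes a b c :: real
  assumes ab: "a > b" and bc: "b > c" and c0: "c > 0"
begin

text \<open>\<open>mu f\<close> and \<open>la p\<close> are the confocal parameters m in [b, a] and
  l in [c, b], written through squared sines. In x^2 = a (a - l) (a - m) / ((a - b) (a - c)) the
  factor a - m becomes (a - b) sin^2 f, so its root can be taken smoothly and with either sign; z is
  treated in the same way through l - c, and y through b - l and m - b.\<close>

definition mu :: "real \<Rightarrow> real" where "mu f = a - (a - b) * (sin f)\<^sup>2"
definition la :: "real \<Rightarrow> real" where "la p = c + (b - c) * (sin p)\<^sup>2"

text \<open>The chart covers each point other than the umbilical ones twice per period: \<open>(f, p)\<close> and
  \<open>(pi - f, pi - p)\<close> have the same image.\<close>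

definition chart :: "real \<Rightarrow> real \<Rightarrow> real^3" where
  "chart f p = vec3 (sqrt (a / (a - c)) * sin f * sqrt (a - la p))
                    (sqrt b * cos f * cos p)
                    (sqrt (c / (a - c)) * sin p * sqrt (mu f - c))"

definition chart_f :: "real \<Rightarrow> real \<Rightarrow> real^3" where
  "chart_f f p = vec3 (sqrt (a / (a - c)) * cos f * sqrt (a - la p))
                      (- (sqrt b * sin f * cos p))
                      (- (sqrt (c / (a - c)) * sin p * ((a - b) * sin f * cos f / sqrt (mu f - c))))"

definition chart_p :: "real \<Rightarrow> real \<Rightarrow> real^3" where
  "chart_p f p = vec3 (- (sqrt (a / (a - c)) * sin f * ((b - c) * sin p * cos p / sqrt (a - la p))))
                      (- (sqrt b * cos f * sin p))
                      (sqrt (c / (a - c)) * cos p * sqrt (mu f - c))"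

lemma mu_bounds: "b \<le> mu f" "mu f \<le> a" "mu f - c > 0" "mu f > 0"
proof -
  have "(sin f)\<^sup>2 \<le> 1" by (simp add: abs_square_le_1)
  then have "(a - b) * (sin f)\<^sup>2 \<le> (a - b) * 1" using ab by (intro mult_left_mono) auto
  then show "b \<le> mu f" by (simp add: mu_def)
  then show "mu f - c > 0" "mu f > 0" using bc c0 by auto
  show "mu f \<le> a" using ab by (simp add: mu_def)
qed

lemma la_bounds: "la p \<le> b" "c \<le> la p" "a - la p > 0" "la p > 0"
proof -
  have "(sin p)\<^sup>2 \<le> 1" by (simp add: abs_square_le_1)
  then have "(b - c) * (sin p)\<^sup>2 \<le> (b - c) * 1" using bc by (intro mult_left_mono) auto
  then show "la p \<le> b" by (simp add: la_def)
  then show "a - la p > 0" using ab by auto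
  show "c \<le> la p" using bc by (simp add: la_def)
  then show "la p > 0" using c0 by auto
qed

lemma continuous_on_mu [continuous_intros]:
  fixes S :: "'x :: t2_space set"
  assumes "continuous_on S g"
  shows "continuous_on S (\<lambda>x. mu (g x))"
  unfolding mu_def by (intro continuous_intros assms)

lemma continuous_on_la [continuous_intros]:
  fixes S :: "'x :: t2_space set"
  assumes "continuous_on S g"
  shows "continuous_on S (\<lambda>x. la (g x))"
  unfolding la_def by (intro continuous_intros assms)

lemma chart_in_ellipsoid: "chart f p \<in> ellipsoid a b c"
proof -
  define S where "S = (sin f)\<^sup>2"
  define R where "R = (sin p)\<^sup>2"
  have C: "(cos f)\<^sup>2 = 1 - S" "(cos p)\<^sup>2 = 1 - R" by (auto simp: S_def R_def cos_squared_eq)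
  have "S * (a - (c + (b - c) * R)) / (a - c) + (1 - S) * (1 - R) + R * (a - (a - b) * S - c) / (a - c) = 1"
  proof -
    have "a - c \<noteq> 0" using ab bc by simp
    then show ?thesis by (simp add: divide_simps) (simp add: algebra_simps)
  qed
  then show ?thesis
    using ab bc c0 la_bounds[of p] mu_bounds[of f]
    by (simp add: ellipsoid_def chart_def power_mult_distrib S_def[symmetric] R_def[symmetric] C la_def mu_def)
qed

text \<open>The squared lengths of the coordinate tangents are rational in sin^2 f and sin^2 p, and
  the tangents are orthogonal. At \<open>mu f = la p\<close> both tangents vanish: the chart is
  singular exactly there.\<close>

lemma chart_metric:
  "(norm (v *\<^sub>R chart_f f p + w *\<^sub>R chart_p f p))\<^sup>2 =
     (mu f - la p) * (mu f / (mu f - c) * v\<^sup>2 + la p / (a - la p) * w\<^sup>2)"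
proof -
  define S where "S = sin f"
  define R where "R = sin p"
  define C where "C = cos f"
  define D where "D = cos p"
  define m where "m = mu f"
  define l where "l = la p"
  have SC: "C\<^sup>2 = 1 - S\<^sup>2" "D\<^sup>2 = 1 - R\<^sup>2"
    by (auto simp: S_def R_def C_def D_def cos_squared_eq)
  have ml: "m = a - (a - b) * S\<^sup>2" "l = c + (b - c) * R\<^sup>2"
    by (auto simp: S_def R_def m_def l_def mu_def la_def)
  have pos: "m - c > 0" "a - l > 0" using mu_bounds la_bounds by (auto simp: m_def l_def)
  define k1 where "k1 = sqrt (a / (a - c))"
  define k3 where "k3 = sqrt (c / (a - c))"
  define s1 where "s1 = sqrt (a - l)"
  define s3 where "s3 = sqrt (m - c)"
  have k: "k1\<^sup>2 = a / (a - c)" "k3\<^sup>2 = c / (a - c)" "(sqrt b)\<^sup>2 = b"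
    using ab bc c0 by (auto simp: k1_def k3_def)
  have s: "s1\<^sup>2 = a - l" "s3\<^sup>2 = m - c" "s1 > 0" "s3 > 0"
    using pos by (auto simp: s1_def s3_def)
  have ff: "(k1 * C * s1)\<^sup>2 + (sqrt b * S * D)\<^sup>2 + (k3 * R * ((a - b) * S * C / s3))\<^sup>2
     = (m - l) * (m / (m - c))"
  proof -
    have "a / (a - c) * (1 - X) * (a - (c + (b - c) * Y)) + b * X * (1 - Y) +
        c / (a - c) * Y * ((a - b)\<^sup>2 * X * (1 - X) / (a - (a - b) * X - c)) =
        (a - (a - b) * X - (c + (b - c) * Y)) * ((a - (a - b) * X) / (a - (a - b) * X - c))"
      if "a - (a - b) * X - c > 0" for X Y
      using that ab bc by (simp add: divide_simps) algebra
    from this[of "S\<^sup>2" "R\<^sup>2"] pos show ?thesis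
      by (simp add: power_mult_distrib power_divide k s SC ml)
  qed
  have pp: "(k1 * S * ((b - c) * R * D / s1))\<^sup>2 + (sqrt b * C * R)\<^sup>2 + (k3 * D * s3)\<^sup>2
     = (m - l) * (l / (a - l))"
  proof -
    have "a / (a - c) * X * ((b - c)\<^sup>2 * Y * (1 - Y) / (a - (c + (b - c) * Y))) + b * (1 - X) * Y +
        c / (a - c) * (1 - Y) * (a - (a - b) * X - c) =
        (a - (a - b) * X - (c + (b - c) * Y)) * ((c + (b - c) * Y) / (a - (c + (b - c) * Y)))"
      if "a - (c + (b - c) * Y) > 0" for X Y
      using that ab bc by (simp add: divide_simps) algebra
    from this[of "R\<^sup>2" "S\<^sup>2"] pos show ?thesis
      by (simp add: power_mult_distrib power_divide k s SC ml)
  qed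
  have fp: "(k1 * C * s1) * (- (k1 * S * ((b - c) * R * D / s1))) + (- (sqrt b * S * D)) * (- (sqrt b * C * R))
     + (- (k3 * R * ((a - b) * S * C / s3))) * (k3 * D * s3) = 0"
  proof -
    have "(k1 * C * s1) * (- (k1 * S * ((b - c) * R * D / s1))) + (- (sqrt b * S * D)) * (- (sqrt b * C * R))
     + (- (k3 * R * ((a - b) * S * C / s3))) * (k3 * D * s3)
      = C * S * R * D * (- k1\<^sup>2 * (b - c) + (sqrt b)\<^sup>2 - k3\<^sup>2 * (a - b))"
      using s(3,4) by (simp add: field_simps power2_eq_square)
    \<comment> \<open>This is a (b - c) + c (a - b) = b (a - c).\<close>
    also have "- k1\<^sup>2 * (b - c) + (sqrt b)\<^sup>2 - k3\<^sup>2 * (a - b) = 0"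
      unfolding k using ab bc by (simp add: field_simps)
    finally show ?thesis by simp
  qed
  have gen: "(v * x1 + w * y1)\<^sup>2 + (v * x2 + w * y2)\<^sup>2 + (v * x3 + w * y3)\<^sup>2
     = v\<^sup>2 * (x1\<^sup>2 + x2\<^sup>2 + x3\<^sup>2) + w\<^sup>2 * (y1\<^sup>2 + y2\<^sup>2 + y3\<^sup>2) + 2 * v * w * (x1 * y1 + x2 * y2 + x3 * y3)"
    for x1 x2 x3 y1 y2 y3 :: real by (simp add: algebra_simps power2_eq_square)
  have "(norm (v *\<^sub>R chart_f f p + w *\<^sub>R chart_p f p))\<^sup>2 =
    v\<^sup>2 * ((k1 * C * s1)\<^sup>2 + (- (sqrt b * S * D))\<^sup>2 + (- (k3 * R * ((a - b) * S * C / s3)))\<^sup>2)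
    + w\<^sup>2 * ((- (k1 * S * ((b - c) * R * D / s1)))\<^sup>2 + (- (sqrt b * C * R))\<^sup>2 + (k3 * D * s3)\<^sup>2)
    + 2 * v * w * ((k1 * C * s1) * (- (k1 * S * ((b - c) * R * D / s1))) + (- (sqrt b * S * D)) * (- (sqrt b * C * R))
     + (- (k3 * R * ((a - b) * S * C / s3))) * (k3 * D * s3))"
    unfolding gen[symmetric] norm_vec_3 chart_f_def chart_p_def
    by (simp add: S_def C_def R_def D_def k1_def k3_def s1_def s3_def m_def l_def)
  also have "\<dots> = (m - l) * (m / (m - c) * v\<^sup>2 + l / (a - l) * w\<^sup>2)"
    unfolding fp power2_minus ff pp by (simp add: algebra_simps)
  finally show ?thesis by (simp add: m_def l_def)
qed

lemma has_derivative_chart: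
  "((\<lambda>z. chart (fst z) (snd z)) has_derivative
     (\<lambda>h. fst h *\<^sub>R chart_f (fst z) (snd z) + snd h *\<^sub>R chart_p (fst z) (snd z))) (at z within X)"
proof -
  have pos: "a - la (snd z) > 0" "mu (fst z) - c > 0" using la_bounds mu_bounds by auto
  define sl where "sl = (\<lambda>z::real \<times> real. sqrt (a - la (snd z)))"
  define sm where "sm = (\<lambda>z::real \<times> real. sqrt (mu (fst z) - c))"
  have dl: "(sl has_derivative
      (\<lambda>h. snd h * - ((b - c) * sin (snd z) * cos (snd z) / sl z))) (at z within X)"
    using pos unfolding la_def sl_def
    by (auto intro!: derivative_eq_intros simp: divide_simps)
  have dm: "(sm has_derivative
      (\<lambda>h. fst h * - ((a - b) * sin (fst z) * cos (fst z) / sm z))) (at z within X)"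
    using pos unfolding mu_def sm_def
    by (auto intro!: derivative_eq_intros simp: divide_simps)
  have "((\<lambda>z. vec3 (sqrt (a / (a - c)) * sin (fst z) * sl z)
                    (sqrt b * cos (fst z) * cos (snd z))
                    (sqrt (c / (a - c)) * sin (snd z) * sm z)) has_derivative
     (\<lambda>h. vec3
        (fst h * (sqrt (a / (a - c)) * cos (fst z) * sl z) +
           snd h * - (sqrt (a / (a - c)) * sin (fst z) * ((b - c) * sin (snd z) * cos (snd z) / sl z)))
        (fst h * - (sqrt b * sin (fst z) * cos (snd z)) + snd h * - (sqrt b * cos (fst z) * sin (snd z)))
        (fst h * - (sqrt (c / (a - c)) * sin (snd z) * ((a - b) * sin (fst z) * cos (fst z) / sm z)) +
           snd h * (sqrt (c / (a - c)) * cos (snd z) * sm z)))) (at z within X)"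
    by (intro has_derivative_vec3)
      (auto intro!: derivative_eq_intros dl dm simp: algebra_simps)
  then have "((\<lambda>z. chart (fst z) (snd z)) has_derivative
     (\<lambda>h. vec3
        (fst h * (sqrt (a / (a - c)) * cos (fst z) * sl z) +
           snd h * - (sqrt (a / (a - c)) * sin (fst z) * ((b - c) * sin (snd z) * cos (snd z) / sl z)))
        (fst h * - (sqrt b * sin (fst z) * cos (snd z)) + snd h * - (sqrt b * cos (fst z) * sin (snd z)))
        (fst h * - (sqrt (c / (a - c)) * sin (snd z) * ((a - b) * sin (fst z) * cos (fst z) / sm z)) +
           snd h * (sqrt (c / (a - c)) * cos (snd z) * sm z)))) (at z within X)"
    by (simp add: chart_def sl_def sm_def)
  then show ?thesis
    by (rule has_derivative_eq_rhs)
      (auto simp: vec_eq_iff forall_3 chart_f_def chart_p_def sl_def sm_def)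
qed

lemma continuous_on_chart [continuous_intros]:
  fixes S :: "'x :: t2_space set"
  assumes "continuous_on S f" "continuous_on S p"
  shows "continuous_on S (\<lambda>x. chart (f x) (p x))" "continuous_on S (\<lambda>x. chart_f (f x) (p x))"
    "continuous_on S (\<lambda>x. chart_p (f x) (p x))"
  unfolding chart_def chart_f_def chart_p_def
  using mu_bounds(3) la_bounds(3)
  by (auto intro!: continuous_intros assms simp: less_imp_neq[symmetric])

lemma chart_curve:
  assumes "(u has_real_derivative u') (at t)" "(v has_real_derivative v') (at t)"
  shows "((\<lambda>t. chart (u t) (v t)) has_vector_derivative
     (u' *\<^sub>R chart_f (u t) (v t) + v' *\<^sub>R chart_p (u t) (v t))) (at t)"
proof -
  have "((\<lambda>t. (u t, v t)) has_derivative (\<lambda>h. (h * u', h * v'))) (at t)"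
    using assms by (intro has_derivative_Pair) (auto simp: has_field_derivative_def mult.commute[of _ u'] mult.commute[of _ v'])
  from has_derivative_compose[OF this has_derivative_chart]
  show ?thesis
    by (simp add: has_vector_derivative_def algebra_simps)
qed


section \<open>Action and length\<close>

text \<open>With N = mu - la and q the quadratic form in the velocities, these are the parts of (N +
  q) / 2 that depend on one coordinate each. \<open>V2\<close> is negative, so the action of the
  second coordinate alone may be negative; only the sum of both bounds a length.\<close>

definition V1 :: "real \<Rightarrow> real" where "V1 f = mu f / 2"
definition W1 :: "real \<Rightarrow> real" where "W1 f = mu f / (mu f - c) / 2"
definition V2 :: "real \<Rightarrow> real" where "V2 p = - la p / 2"
definition W2 :: "real \<Rightarrow> real" where "W2 p = la p / (a - la p) / 2"

text \<open>The infimum of the action over curves in the chart and over all durations is at most \<open>L\<close>.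
  The two coordinates need only share the duration \<open>T\<close>.\<close>

definition action_le :: "real \<Rightarrow> real \<Rightarrow> real \<Rightarrow> real \<Rightarrow> real \<Rightarrow> bool" where
  "action_le f p f' p' L \<longleftrightarrow> (\<forall>e>0. \<exists>T A B. action_path V1 W1 T f f' A \<and>
     action_path V2 W2 T p p' B \<and> A + B \<le> L + e)"

lemma speed_le_action:
  "norm (v *\<^sub>R chart_f f p + w *\<^sub>R chart_p f p) \<le> (V1 f + W1 f * v\<^sup>2) + (V2 p + W2 p * w\<^sup>2)"
proof -
  define N where "N = mu f - la p"
  define q where "q = mu f / (mu f - c) * v\<^sup>2 + la p / (a - la p) * w\<^sup>2"
  have "N \<ge> 0" "q \<ge> 0"
    using mu_bounds[of f] la_bounds[of p] by (auto simp: N_def q_def)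
  moreover have "norm (v *\<^sub>R chart_f f p + w *\<^sub>R chart_p f p) = sqrt (N * q)"
    by (rule real_sqrt_unique[symmetric]) (simp_all add: chart_metric N_def q_def)
  moreover have "(V1 f + W1 f * v\<^sup>2) + (V2 p + W2 p * w\<^sup>2) = (N + q) / 2"
  proof -
    have "(x + E / 2 * v\<^sup>2) + (y + G / 2 * w\<^sup>2) = ((2 * x + 2 * y) + (E * v\<^sup>2 + G * w\<^sup>2)) / 2"
      for x y E G :: real by (simp add: field_simps)
    note this[of "V1 f" "mu f / (mu f - c)" "V2 p" "la p / (a - la p)"]
    moreover have "2 * V1 f + 2 * V2 p = N" by (simp add: V1_def V2_def N_def)
    ultimately show ?thesis unfolding W1_def W2_def q_def by (simp only:)
  qed
  ultimately show ?thesis using arith_geo_mean_sqrt[of N q] by simp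
qed

text \<open>The pointwise bound of speed by action is integrated after rescaling [0, T] to [0, 1].
  The point to settle is that the speed is integrable at all.\<close>

lemma action_paths_imp_path:
  assumes "action_path V1 W1 T f f' A" "action_path V2 W2 T p p' B"
  obtains g L where "valid_path g" "path_image g \<subseteq> ellipsoid a b c"
    "pathstart g = chart f p" "pathfinish g = chart f' p'"
    "((\<lambda>t. norm (vector_derivative g (at t))) has_integral L) {0..1}" "L \<le> A + B"
proof -
  from assms(1) obtain u u' S where T: "T > 0" and S: "finite S" and cu: "continuous_on {0..T} u"
    and du: "\<And>t. t \<in> {0<..<T} - S \<Longrightarrow> (u has_real_derivative u' t) (at t)"
    and cu': "continuous_on ({0<..<T} - S) u'" and e: "u 0 = f" "u T = f'"
    and I: "((\<lambda>t. V1 (u t) + W1 (u t) * (u' t)\<^sup>2) has_integral A) {0..T}"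
    by (blast elim: action_pathE)
  from assms(2) obtain v v' R where R: "finite R" and cv: "continuous_on {0..T} v"
    and dv: "\<And>t. t \<in> {0<..<T} - R \<Longrightarrow> (v has_real_derivative v' t) (at t)"
    and cv': "continuous_on ({0<..<T} - R) v'" and e': "v 0 = p" "v T = p'"
    and J: "((\<lambda>t. V2 (v t) + W2 (v t) * (v' t)\<^sup>2) has_integral B) {0..T}"
    by (blast elim: action_pathE)
  \<comment> \<open>The endpoints are included because \<open>action_path\<close> gives derivatives
    only at interior times.\<close>
  define Q where "Q = {0, 1} \<union> (\<lambda>t. t / T) ` (S \<union> R)"
  define g where "g = (\<lambda>t. chart (u (T * t)) (v (T * t)))"
  define D where "D = (\<lambda>t. (u' (T * t) * T) *\<^sub>R chart_f (u (T * t)) (v (T * t))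
                         + (v' (T * t) * T) *\<^sub>R chart_p (u (T * t)) (v (T * t)))"
  define F where "F = (\<lambda>t. (V1 (u t) + W1 (u t) * (u' t)\<^sup>2) + (V2 (v t) + W2 (v t) * (v' t)\<^sup>2))"
  have Q: "finite Q" using S R by (simp add: Q_def)
  have mem: "T * t \<in> {0<..<T} - S" "T * t \<in> {0<..<T} - R" if "t \<in> {0..1} - Q" for t
    using that T by (force simp: Q_def)+
  have dg: "(g has_vector_derivative D t) (at t)" if "t \<in> {0..1} - Q" for t
    unfolding g_def D_def
    by (intro chart_curve DERIV_chain2[where f = u and g = "\<lambda>t. T * t"]
          DERIV_chain2[where f = v and g = "\<lambda>t. T * t"] du dv mem[OF that])
      (auto intro!: derivative_eq_intros)
  have cg: "continuous_on {0..1} g"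
    unfolding g_def using T
    by (intro continuous_intros continuous_on_compose2[OF cu] continuous_on_compose2[OF cv])
      (auto intro!: continuous_intros)
  have cD: "continuous_on ({0..1} - Q) D"
    unfolding D_def using T
    by (intro continuous_intros continuous_on_compose2[OF cu] continuous_on_compose2[OF cv]
          continuous_on_compose2[OF cu'] continuous_on_compose2[OF cv'])
      (use mem in \<open>auto intro!: continuous_intros\<close>)
  have "(F has_integral A + B) {0..T}"
    unfolding F_def by (rule has_integral_add[OF I J])
  from has_integral_affinity'[OF this[folded cbox_interval], of T 0] T
  have "((\<lambda>t. F (T * t)) has_integral (A + B) / T) {0..1}"
    by (simp add: field_simps)
  from has_integral_mult_right[OF this, of T] T
  have H: "((\<lambda>t. T * F (T * t)) has_integral A + B) {0..1}" by simp
  have le: "norm (D t) \<le> T * F (T * t)" for t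
  proof -
    have "D t = T *\<^sub>R (u' (T * t) *\<^sub>R chart_f (u (T * t)) (v (T * t)) + v' (T * t) *\<^sub>R chart_p (u (T * t)) (v (T * t)))"
      by (simp add: D_def scaleR_add_right mult.commute)
    then show ?thesis
      using speed_le_action[of "u' (T * t)" "u (T * t)" "v (T * t)" "v' (T * t)"] T
      by (simp add: F_def)
  qed
  have neg: "negligible (({0..1} - Q) - {0..1})" "negligible ({0..1} - ({0..1} - Q))"
    using Q by (auto intro!: negligible_finite intro: finite_subset[OF _ Q])
  have meas: "{0..1} - Q \<in> sets lebesgue"
    using Q by (intro sets.Diff) (auto intro: negligible_imp_sets negligible_finite)
  have H': "((\<lambda>t. T * F (T * t)) has_integral A + B) ({0..1} - Q)"
    using H by (subst has_integral_spike_set_eq[OF negligible_subset[OF neg(1)] negligible_subset[OF neg(2)]]) auto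
  \<comment> \<open>The speed may be unbounded near \<open>Q\<close>. It is continuous off
    \<open>Q\<close>, hence measurable there, and has the integrable majorant
    \<open>T * F (T * t)\<close>.\<close>
  have "(\<lambda>t. norm (D t)) integrable_on ({0..1} - Q)"
    by (rule measurable_bounded_by_integrable_imp_integrable[OF _ has_integral_integrable[OF H'] _ meas])
      (use le in \<open>auto intro!: continuous_imp_measurable_on_sets_lebesgue continuous_intros cD meas\<close>)
  then obtain L where L: "((\<lambda>t. norm (D t)) has_integral L) ({0..1} - Q)" by blast
  have "((\<lambda>t. norm (vector_derivative g (at t))) has_integral L) ({0..1} - Q)"
    using L by (rule has_integral_eq[rotated]) (simp only: vector_derivative_at[OF dg])
  then have "((\<lambda>t. norm (vector_derivative g (at t))) has_integral L) {0..1}"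
    by (subst has_integral_spike_set_eq[OF negligible_subset[OF neg(2)] negligible_subset[OF neg(1)]]) auto
  moreover have "L \<le> A + B"
    using has_integral_le[OF L H'] le by blast
  moreover have "valid_path g"
    unfolding valid_path_def piecewise_C1_differentiable_on_def C1_differentiable_on_def
    using cg Q dg cD by blast
  moreover have "path_image g \<subseteq> ellipsoid a b c"
    using chart_in_ellipsoid by (auto simp: path_image_def g_def)
  ultimately show ?thesis
    using that[of g L] e e' by (simp add: pathstart_def pathfinish_def g_def)
qed

text \<open>The two coordinate paths are coupled only by their common duration, so the second one
  may be reversed while the first is kept.\<close>

lemma action_le_swap: "action_le f p f' p' L \<Longrightarrow> action_le f p' f' p L"
  unfolding action_le_def by (meson action_path_reverse)

lemma action_le_sym: "action_le f p f' p' L \<Longrightarrow> action_le f' p' f p L"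
  unfolding action_le_def by (meson action_path_reverse)

lemma action_le_trans:
  assumes "action_le f p f' p' L" "action_le f' p' f'' p'' M"
  shows "action_le f p f'' p'' (L + M)"
  unfolding action_le_def
proof (intro allI impI)
  fix e :: real assume "e > 0"
  then have "e / 2 > 0" by simp
  with assms obtain T A B T' A' B' where
    "action_path V1 W1 T f f' A" "action_path V2 W2 T p p' B" "A + B \<le> L + e / 2"
    "action_path V1 W1 T' f' f'' A'" "action_path V2 W2 T' p' p'' B'" "A' + B' \<le> M + e / 2"
    unfolding action_le_def by meson
  then show "\<exists>T A B. action_path V1 W1 T f f'' A \<and> action_path V2 W2 T p p'' B \<and> A + B \<le> L + M + e"
    by (intro exI[of _ "T + T'"] exI[of _ "A + A'"] exI[of _ "B + B'"] conjI)
      (auto intro: action_path_join)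
qed

text \<open>The coefficients depend on the angles through squared sines only, so the two coordinates
  can be moved by independent symmetries.\<close>

lemma action_le_isometry:
  assumes "action_le f p f' p' L" and s: "s \<in> {1, -1}" "r \<in> {1, -1}"
    and k: "\<And>t. (sin (s * t + k))\<^sup>2 = (sin t)\<^sup>2" and j: "\<And>t. (sin (r * t + j))\<^sup>2 = (sin t)\<^sup>2"
  shows "action_le (s * f + k) (r * p + j) (s * f' + k) (r * p' + j) L"
proof -
  have "V1 (s * t + k) = V1 t" "W1 (s * t + k) = W1 t" "V2 (r * t + j) = V2 t" "W2 (r * t + j) = W2 t" for t
    by (simp_all add: V1_def V2_def W1_def W2_def mu_def la_def k j)
  then show ?thesis
    using assms(1) action_path_isometry[OF _ s(1)] action_path_isometry[OF _ s(2)]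
    unfolding action_le_def by meson
qed

lemma continuous_actions:
  "continuous_on UNIV V1" "continuous_on UNIV W1" "continuous_on UNIV V2" "continuous_on UNIV W2"
  using mu_bounds(3) la_bounds(3)
  by (auto simp: V1_def[abs_def] W1_def[abs_def] V2_def[abs_def] W2_def[abs_def]
     less_imp_neq[symmetric] intro!: continuous_intros)

text \<open>A short duration makes the potential cheap, and then a small distance makes the kinetic
  term cheap. The bound is uniform in the points and does not degenerate where mu = la.\<close>

lemma action_le_close:
  assumes "e > 0"
  obtains d where "d > 0" "\<And>f p f' p'. \<bar>f' - f\<bar> < d \<Longrightarrow> \<bar>p' - p\<bar> < d \<Longrightarrow> action_le f p f' p' e"
proof -
  define K where "K = a / (b - c) + b / (a - b)"
  \<comment> \<open>As \<open>V1\<close> is at most a / 2 and \<open>V2\<close> at most 0, the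
    potential costs at most e / 2 during this time.\<close>
  define T where "T = e / a"
  have a0: "a > 0" and K: "K > 0" using ab bc c0 by (auto simp: K_def add_pos_pos)
  then have T: "T > 0" using assms by (simp add: T_def)
  have W: "W1 f \<le> K" "W2 p \<le> K" for f p
  proof -
    have "mu f / (mu f - c) \<le> a / (b - c)" "la p / (a - la p) \<le> b / (a - b)"
      using mu_bounds[of f] la_bounds[of p] ab bc c0 by (auto intro!: frac_le)
    moreover have "a / (b - c) > 0" "b / (a - b) > 0" "mu f / (mu f - c) > 0" "la p / (a - la p) > 0"
      using mu_bounds[of f] la_bounds[of p] ab bc c0 by auto
    moreover have "x / 2 \<le> X + Y" if "x \<le> X \<or> x \<le> Y" "0 < x" "0 < X" "0 < Y" for x X Y :: real
      using that by linarith
    ultimately show "W1 f \<le> K" "W2 p \<le> K" unfolding W1_def W2_def K_def by blast+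
  qed
  have V: "V1 f \<le> a / 2" "V2 p \<le> 0" for f p
    using mu_bounds[of f] la_bounds[of p] by (auto simp: V1_def V2_def)
  \<comment> \<open>This makes K d^2 / T equal to e / 4, one such share for each coordinate.\<close>
  define d where "d = sqrt (e * T / (4 * K))"
  have d: "d > 0" using assms T K by (simp add: d_def)
  show ?thesis
  proof (rule that[OF d])
    fix f p f' p' assume le: "\<bar>f' - f\<bar> < d" "\<bar>p' - p\<bar> < d"
    have "(f' - f)\<^sup>2 \<le> d\<^sup>2" "(p' - p)\<^sup>2 \<le> d\<^sup>2"
      using le d by (auto simp: abs_le_square_iff[symmetric])
    then have sq: "K * (f' - f)\<^sup>2 / T \<le> e / 4" "K * (p' - p)\<^sup>2 / T \<le> e / 4"
      using assms T K by (auto simp: d_def field_simps)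
    obtain A where A: "action_path V1 W1 T f f' A" "A \<le> T * (a / 2) + K * (f' - f)\<^sup>2 / T"
      by (rule action_path_linear[OF T continuous_actions(1,2), of f f' "a / 2" K]) (use V W in auto)
    obtain B where B: "action_path V2 W2 T p p' B" "B \<le> T * 0 + K * (p' - p)\<^sup>2 / T"
      by (rule action_path_linear[OF T continuous_actions(3,4), of p p' 0 K]) (use V W in auto)
    have "T * (a / 2) = e / 2" using a0 by (simp add: T_def)
    with A(2) B(2) sq have "A + B \<le> e" by linarith
    then show "action_le f p f' p' e"
      unfolding action_le_def using A B by (smt (verit))
  qed
qed

text \<open>Strict differentiability: both points vary while the derivative stays at
  \<open>z0\<close>. It follows from the mean value inequality on a ball where each of the two
  partial derivatives moves by less than e / 2.\<close>

lemma chart_strict_derivative: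
  assumes "e > 0"
  obtains d where "d > 0" "\<And>z z'. dist z z0 < d \<Longrightarrow> dist z' z0 < d \<Longrightarrow>
    norm (chart (fst z') (snd z') - chart (fst z) (snd z) -
      ((fst z' - fst z) *\<^sub>R chart_f (fst z0) (snd z0) + (snd z' - snd z) *\<^sub>R chart_p (fst z0) (snd z0)))
    \<le> e * norm (z' - z)"
proof -
  have "isCont (\<lambda>z. chart_f (fst z) (snd z)) z0" "isCont (\<lambda>z. chart_p (fst z) (snd z)) z0"
    using continuous_on_chart[of "UNIV :: (real \<times> real) set" fst snd]
    by (cases z0; simp add: continuous_on_eq_continuous_at continuous_on_fst continuous_on_snd)+
  moreover have "e / 2 > 0" using assms by simp
  ultimately obtain d1 d2 where d: "d1 > 0" "d2 > 0"
    "\<And>z. dist z z0 < d1 \<Longrightarrow> dist (chart_f (fst z) (snd z)) (chart_f (fst z0) (snd z0)) < e / 2"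
    "\<And>z. dist z z0 < d2 \<Longrightarrow> dist (chart_p (fst z) (snd z)) (chart_p (fst z0) (snd z0)) < e / 2"
    unfolding continuous_at_eps_delta by metis
  define d where "d = min d1 d2"
  have d0: "d > 0" using d by (simp add: d_def)
  show ?thesis
  proof (rule that[OF d0])
    fix z z' assume z: "dist z z0 < d" "dist z' z0 < d"
    have "norm (chart (fst z') (snd z') - chart (fst z) (snd z) -
      (\<lambda>h. fst h *\<^sub>R chart_f (fst z0) (snd z0) + snd h *\<^sub>R chart_p (fst z0) (snd z0)) (z' - z))
      \<le> norm (z' - z) * e"
    proof (rule differentiable_bound_linearization[where S = "ball z0 d" and
         f' = "\<lambda>z h. fst h *\<^sub>R chart_f (fst z) (snd z) + snd h *\<^sub>R chart_p (fst z) (snd z)"])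
      show "z + t *\<^sub>R (z' - z) \<in> ball z0 d" if "t \<in> {0..1}" for t
      proof -
        have "(1 - t) *\<^sub>R z + t *\<^sub>R z' \<in> ball z0 d"
          using convexD_alt[OF convex_ball, of z z0 d z' t] z that by (simp add: dist_commute)
        moreover have "(1 - t) *\<^sub>R z + t *\<^sub>R z' = z + t *\<^sub>R (z' - z)" by (simp add: algebra_simps)
        ultimately show ?thesis by simp
      qed
      show "onorm ((\<lambda>h. fst h *\<^sub>R chart_f (fst x) (snd x) + snd h *\<^sub>R chart_p (fst x) (snd x)) -
        (\<lambda>h. fst h *\<^sub>R chart_f (fst z0) (snd z0) + snd h *\<^sub>R chart_p (fst z0) (snd z0))) \<le> e"
        if x: "x \<in> ball z0 d" for x
      proof (rule onorm_le)
        fix h :: "real \<times> real"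
        let ?P = "chart_f (fst x) (snd x) - chart_f (fst z0) (snd z0)"
        let ?Q = "chart_p (fst x) (snd x) - chart_p (fst z0) (snd z0)"
        have PQ: "norm ?P \<le> e / 2" "norm ?Q \<le> e / 2"
          using x d(3,4)[of x] by (auto simp: d_def dist_norm dist_commute less_imp_le norm_minus_commute)
        have "norm (fst h *\<^sub>R ?P + snd h *\<^sub>R ?Q) \<le> \<bar>fst h\<bar> * norm ?P + \<bar>snd h\<bar> * norm ?Q"
          by (metis norm_scaleR norm_triangle_ineq)
        also have "\<dots> \<le> norm h * (e / 2) + norm h * (e / 2)"
          using PQ norm_fst_le[of "fst h" "snd h"] norm_snd_le[of "snd h" "fst h"]
          by (intro add_mono mult_mono) auto
        finally show "norm (((\<lambda>h. fst h *\<^sub>R chart_f (fst x) (snd x) + snd h *\<^sub>R chart_p (fst x) (snd x)) -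
          (\<lambda>h. fst h *\<^sub>R chart_f (fst z0) (snd z0) + snd h *\<^sub>R chart_p (fst z0) (snd z0))) h) \<le> e * norm h"
          by (simp add: algebra_simps)
      qed
    qed (use d0 in \<open>auto intro: has_derivative_chart\<close>)
    then show "norm (chart (fst z') (snd z') - chart (fst z) (snd z) -
      ((fst z' - fst z) *\<^sub>R chart_f (fst z0) (snd z0) + (snd z' - snd z) *\<^sub>R chart_p (fst z0) (snd z0)))
      \<le> e * norm (z' - z)" by (simp add: mult.commute)
  qed
qed

text \<open>Where mu > la, strict differentiability bounds the chord from below by almost sqrt (N
  q), and uniform motion with the best duration bounds the action from above by almost the same
  number.\<close>

lemma action_le_local:
  assumes z0: "la (snd z0) < mu (fst z0)" and "e > 0"
  obtains d where "d > 0" "\<And>z z'. dist z z0 < d \<Longrightarrow> dist z' z0 < d \<Longrightarrow>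
     action_le (fst z) (snd z) (fst z') (snd z')
       ((1 + e) * norm (chart (fst z') (snd z') - chart (fst z) (snd z)))"
proof -
  \<comment> \<open>The solution of (1 + e1) / (1 - e1) = 1 + e; the upper and the lower estimate
    may each be off by the proportion \<open>e1\<close>.\<close>
  define e1 where "e1 = e / (2 + e)"
  have e1: "e1 > 0" "e1 < 1" "1 + e1 \<le> (1 + e) * (1 - e1)"
    using assms(2) by (auto simp: e1_def divide_simps algebra_simps)
  define N where "N = mu (fst z0) - la (snd z0)"
  define E where "E = mu (fst z0) / (mu (fst z0) - c)"
  define G where "G = la (snd z0) / (a - la (snd z0))"
  have pos: "N > 0" "E > 0" "G > 0"
    using z0 mu_bounds[of "fst z0"] la_bounds[of "snd z0"] by (auto simp: N_def E_def G_def)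
  \<comment> \<open>The two potentials together are off by at most 2 k and each kinetic coefficient
    by at most k. With this \<open>k\<close> the errors are absorbed by a factor 1 + e1 on N, E and
    G.\<close>
  define k where "k = min (e1 * N / 4) (min (e1 * E / 2) (e1 * G / 2))"
  have k: "k > 0" "2 * k \<le> e1 * N / 2" "k \<le> e1 * E / 2" "k \<le> e1 * G / 2"
    using e1 pos by (auto simp: k_def)
  have cont: "\<exists>d>0. \<forall>y. \<bar>y - x\<bar> < d \<longrightarrow> H y \<le> H x + k" if "continuous_on UNIV H" for H :: "real \<Rightarrow> real" and x
    using that k(1) by (fastforce simp: continuous_on_eq_continuous_at continuous_at_eps_delta dist_real_def)
  from cont[OF continuous_actions(1), of "fst z0"] obtain d1 where
    d1: "d1 > 0" "\<And>y. \<bar>y - fst z0\<bar> < d1 \<Longrightarrow> V1 y \<le> V1 (fst z0) + k" by blast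
  from cont[OF continuous_actions(2), of "fst z0"] obtain d2 where
    d2: "d2 > 0" "\<And>y. \<bar>y - fst z0\<bar> < d2 \<Longrightarrow> W1 y \<le> W1 (fst z0) + k" by blast
  from cont[OF continuous_actions(3), of "snd z0"] obtain d3 where
    d3: "d3 > 0" "\<And>y. \<bar>y - snd z0\<bar> < d3 \<Longrightarrow> V2 y \<le> V2 (snd z0) + k" by blast
  from cont[OF continuous_actions(4), of "snd z0"] obtain d4 where
    d4: "d4 > 0" "\<And>y. \<bar>y - snd z0\<bar> < d4 \<Longrightarrow> W2 y \<le> W2 (snd z0) + k" by blast
  \<comment> \<open>The smallest factor by which the derivative at \<open>z0\<close> stretches
    vectors.\<close>
  define M where "M = sqrt (N * min E G)"
  have "e1 * M > 0" using e1 pos by (simp add: M_def)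
  then obtain d5 where d5: "d5 > 0" "\<And>z z'. dist z z0 < d5 \<Longrightarrow> dist z' z0 < d5 \<Longrightarrow>
    norm (chart (fst z') (snd z') - chart (fst z) (snd z) -
      ((fst z' - fst z) *\<^sub>R chart_f (fst z0) (snd z0) + (snd z' - snd z) *\<^sub>R chart_p (fst z0) (snd z0)))
    \<le> e1 * M * norm (z' - z)"
    using chart_strict_derivative by blast
  define d where "d = min d1 (min d2 (min d3 (min d4 d5)))"
  have d0: "d > 0" using d1 d2 d3 d4 d5 by (simp add: d_def)
  show ?thesis
  proof (rule that[OF d0])
    fix z z' :: "real \<times> real" assume z: "dist z z0 < d" "dist z' z0 < d"
    define v where "v = fst z' - fst z"
    define w where "w = snd z' - snd z"
    define q where "q = E * v\<^sup>2 + G * w\<^sup>2"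
    have q0: "q \<ge> 0" using pos by (simp add: q_def)
    let ?D = "v *\<^sub>R chart_f (fst z0) (snd z0) + w *\<^sub>R chart_p (fst z0) (snd z0)"
    let ?C = "chart (fst z') (snd z') - chart (fst z) (snd z)"
    have nD: "norm ?D = sqrt (N * q)"
      by (rule real_sqrt_unique[symmetric]) (simp_all add: chart_metric N_def q_def E_def G_def)
    have nM: "M * norm (z' - z) \<le> sqrt (N * q)"
    proof -
      have "min E G * (v\<^sup>2 + w\<^sup>2) \<le> q"
        by (auto simp: q_def distrib_left intro!: add_mono mult_right_mono)
      then have "N * min E G * (v\<^sup>2 + w\<^sup>2) \<le> N * q" using pos by (simp add: mult.assoc)
      moreover have "norm (z' - z) = sqrt (v\<^sup>2 + w\<^sup>2)"
        by (simp add: norm_prod_def v_def w_def)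
      ultimately show ?thesis by (simp add: M_def real_sqrt_mult[symmetric])
    qed
    have "norm (?C - ?D) \<le> e1 * M * norm (z' - z)"
      using d5(2)[of z z'] z by (simp add: d_def v_def w_def)
    also have "\<dots> \<le> e1 * sqrt (N * q)" using nM e1 by (simp add: mult.assoc)
    finally have "(1 - e1) * sqrt (N * q) \<le> norm ?C"
      using norm_triangle_ineq3[of ?C ?D] nD by (simp add: algebra_simps)
    then have "(1 + e) * ((1 - e1) * sqrt (N * q)) \<le> (1 + e) * norm ?C"
      using assms(2) by (intro mult_left_mono) auto
    moreover have "(1 + e1) * sqrt (N * q) \<le> (1 + e) * (1 - e1) * sqrt (N * q)"
      using e1 pos q0 by (intro mult_right_mono) auto
    ultimately have lower: "(1 + e1) * sqrt (N * q) \<le> (1 + e) * norm ?C"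
      by (simp add: mult.assoc)
    have seg: "\<bar>y - fst z0\<bar> < d" if "y \<in> closed_segment (fst z) (fst z')" for y
    proof -
      have "\<bar>fst z - fst z0\<bar> < d" "\<bar>fst z' - fst z0\<bar> < d"
        using z dist_fst_le[of z z0] dist_fst_le[of z' z0] by (auto simp: dist_real_def)
      then show ?thesis using that by (auto simp: closed_segment_eq_real_ivl split: if_splits)
    qed
    have seg': "\<bar>y - snd z0\<bar> < d" if "y \<in> closed_segment (snd z) (snd z')" for y
    proof -
      have "\<bar>snd z - snd z0\<bar> < d" "\<bar>snd z' - snd z0\<bar> < d"
        using z dist_snd_le[of z z0] dist_snd_le[of z' z0] by (auto simp: dist_real_def)
      then show ?thesis using that by (auto simp: closed_segment_eq_real_ivl split: if_splits)
    qed
    have upper: "\<exists>A B. action_path V1 W1 T (fst z) (fst z') A \<and> action_path V2 W2 T (snd z) (snd z') B \<and>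
       A + B \<le> (1 + e1) / 2 * (T * N + q / T)" if T: "T > 0" for T
    proof -
      obtain A where A: "action_path V1 W1 T (fst z) (fst z') A"
        "A \<le> T * (V1 (fst z0) + k) + (W1 (fst z0) + k) * v\<^sup>2 / T"
        unfolding v_def
        by (rule action_path_linear[OF T continuous_actions(1,2), of "fst z" "fst z'" "V1 (fst z0) + k" "W1 (fst z0) + k"])
          (use seg d1(2) d2(2) in \<open>auto simp: d_def\<close>)
      obtain B where B: "action_path V2 W2 T (snd z) (snd z') B"
        "B \<le> T * (V2 (snd z0) + k) + (W2 (snd z0) + k) * w\<^sup>2 / T"
        unfolding w_def
        by (rule action_path_linear[OF T continuous_actions(3,4), of "snd z" "snd z'" "V2 (snd z0) + k" "W2 (snd z0) + k"])
          (use seg' d3(2) d4(2) in \<open>auto simp: d_def\<close>)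
      have "T * (V1 (fst z0) + k) + T * (V2 (snd z0) + k) = T * (N / 2 + 2 * k)"
        by (simp add: V1_def V2_def N_def field_simps)
      also have "\<dots> \<le> T * (N / 2 + e1 * N / 2)" using k T by (intro mult_left_mono) auto
      finally have 1: "T * (V1 (fst z0) + k) + T * (V2 (snd z0) + k) \<le> (1 + e1) / 2 * (T * N)"
        by (simp add: field_simps)
      have "(W1 (fst z0) + k) * v\<^sup>2 \<le> ((1 + e1) / 2 * E) * v\<^sup>2"
        by (rule mult_right_mono) (use k in \<open>simp_all add: W1_def E_def[symmetric] algebra_simps\<close>)
      moreover have "(W2 (snd z0) + k) * w\<^sup>2 \<le> ((1 + e1) / 2 * G) * w\<^sup>2"
        by (rule mult_right_mono) (use k in \<open>simp_all add: W2_def G_def[symmetric] algebra_simps\<close>)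
      ultimately have "(W1 (fst z0) + k) * v\<^sup>2 + (W2 (snd z0) + k) * w\<^sup>2 \<le> (1 + e1) / 2 * q"
        using add_mono unfolding q_def distrib_left mult.assoc by blast
      then have "((W1 (fst z0) + k) * v\<^sup>2 + (W2 (snd z0) + k) * w\<^sup>2) / T \<le> (1 + e1) / 2 * q / T"
        using T by (intro divide_right_mono) auto
      with 1 A(2) B(2) have "A + B \<le> (1 + e1) / 2 * (T * N + q / T)"
        by (simp add: algebra_simps add_divide_distrib)
      with A(1) B(1) show ?thesis by blast
    qed
    show "action_le (fst z) (snd z) (fst z') (snd z') ((1 + e) * norm ?C)"
      unfolding action_le_def
    proof (intro allI impI)
      fix r :: real assume r: "r > 0"
      obtain T where T: "T > 0" "(1 + e1) / 2 * (T * N + q / T) \<le> (1 + e) * norm ?C + r"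
      proof (cases "q = 0")
        \<comment> \<open>The points coincide, and the best duration would be 0, which is not
          admissible; waiting for the time r / N costs at most r.\<close>
        case True
        show ?thesis
        proof (rule that[of "r / N"])
          have "(1 + e1) / 2 * r \<le> 1 * r" using e1 r by (intro mult_right_mono) auto
          then show "(1 + e1) / 2 * (r / N * N + q / (r / N)) \<le> (1 + e) * norm ?C + r"
            using True pos assms(2) by (simp add: add_increasing)
        qed (use r pos in auto)
      next
        case False
        with q0 have q1: "q > 0" by simp
        show ?thesis
        \<comment> \<open>This duration makes T N and q / T equal, the equality case of the two
          means.\<close>
        proof (rule that[of "sqrt (q / N)"])
          have "sqrt (q / N) * N = sqrt (N * q)" "q / sqrt (q / N) = sqrt (N * q)"
            using pos q1 by (auto simp: real_sqrt_divide real_sqrt_mult field_simps)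
          then show "(1 + e1) / 2 * (sqrt (q / N) * N + q / sqrt (q / N)) \<le> (1 + e) * norm ?C + r"
            using lower r by simp
        qed (use q1 pos in auto)
      qed
      with upper[OF T(1)] show "\<exists>T A B. action_path V1 W1 T (fst z) (fst z') A \<and>
        action_path V2 W2 T (snd z) (snd z') B \<and> A + B \<le> (1 + e) * norm ?C + r"
        by (meson order_trans)
    qed
  qed
qed

end

section \<open>Inverting the coordinates\<close>

text \<open>For s = 1 the shift \<open>k\<close> is a multiple of 2 pi, for s = -1 an odd multiple
  of pi. Having the map on the whole line lets it be applied to entire paths.\<close>

lemma circle_isometry:
  fixes x x' s :: real
  assumes "sin x' = sin x" "cos x' = s * cos x" and s: "s \<in> {1, -1}"
  obtains k where "x' = s * x + k" "\<And>t. sin (s * t + k) = sin t" "\<And>t. cos (s * t + k) = s * cos t"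
proof -
  define k where "k = x' - s * x"
  have ck: "cos k = s"
  proof -
    have "cos k = s * (cos x * cos x + sin x * sin x)"
      using s assms(1,2) by (auto simp: k_def cos_diff cos_add simp del: sin_cos_squared_add3)
    then show ?thesis by simp
  qed
  have sk: "sin k = 0"
  proof -
    have "(cos k)\<^sup>2 = 1" using ck s by auto
    then show ?thesis using sin_cos_squared_add[of k] by simp
  qed
  show ?thesis
  proof (rule that[of k])
    show "x' = s * x + k" by (simp add: k_def)
  qed (use ck sk s in \<open>auto simp: sin_add sin_diff cos_add cos_diff\<close>)
qed

section \<open>Confocal parameters of a point of the ellipsoid\<close>

context triaxial
begin

text \<open>On the ellipsoid the cleared confocal equation is a cubic in the parameter with root 0.
  Its other two roots have this sum and, by \<open>root_prod\<close>, that product.\<close>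

definition root_sum :: "real^3 \<Rightarrow> real" where
  "root_sum p = a + b + c - ((p$1)\<^sup>2 + (p$2)\<^sup>2 + (p$3)\<^sup>2)"
definition root_prod :: "real^3 \<Rightarrow> real" where
  "root_prod p = a * b + b * c + c * a - ((p$1)\<^sup>2 * (b + c) + (p$2)\<^sup>2 * (a + c) + (p$3)\<^sup>2 * (a + b))"
definition root_lo :: "real^3 \<Rightarrow> real" where
  "root_lo p = (root_sum p - sqrt ((root_sum p)\<^sup>2 - 4 * root_prod p)) / 2"
definition root_hi :: "real^3 \<Rightarrow> real" where
  "root_hi p = (root_sum p + sqrt ((root_sum p)\<^sup>2 - 4 * root_prod p)) / 2"

lemma continuous_on_roots [continuous_intros]:
  fixes S :: "'x :: t2_space set"
  assumes "continuous_on S g"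
  shows "continuous_on S (\<lambda>x. root_lo (g x))" "continuous_on S (\<lambda>x. root_hi (g x))"
proof -
  have "continuous_on S (\<lambda>x. root_sum (g x))" "continuous_on S (\<lambda>x. root_prod (g x))"
    unfolding root_sum_def root_prod_def by (auto intro!: continuous_intros assms)
  then show "continuous_on S (\<lambda>x. root_lo (g x))" "continuous_on S (\<lambda>x. root_hi (g x))"
    unfolding root_lo_def root_hi_def by (auto intro!: continuous_intros)
qed

text \<open>The constant term of the cubic vanishes because the point lies on the ellipsoid, the
  quadric of parameter 0.\<close>

lemma confocal_polynomial:
  assumes "p \<in> ellipsoid a b c"
  shows "(a - t) * (b - t) * (c - t) - (p$1)\<^sup>2 * (b - t) * (c - t) - (p$2)\<^sup>2 * (a - t) * (c - t)
     - (p$3)\<^sup>2 * (a - t) * (b - t) = - t * (t\<^sup>2 - root_sum p * t + root_prod p)"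
proof -
  define X Y Z where "X = (p$1)\<^sup>2" and "Y = (p$2)\<^sup>2" and "Z = (p$3)\<^sup>2"
  have "X / a + Y / b + Z / c = 1" using assms by (simp add: ellipsoid_def X_def Y_def Z_def)
  then have "X * b * c + Y * a * c + Z * a * b = a * b * c"
    using ab bc c0 by (simp add: divide_simps) (simp add: algebra_simps)
  moreover have "(a - t) * (b - t) * (c - t) - X * (b - t) * (c - t) - Y * (a - t) * (c - t) - Z * (a - t) * (b - t)
     = a * b * c - (X * b * c + Y * a * c + Z * a * b)
       - t * (t\<^sup>2 - (a + b + c - (X + Y + Z)) * t + (a * b + b * c + c * a - (X * (b + c) + Y * (a + c) + Z * (a + b))))"
    by (simp add: algebra_simps power2_eq_square)
  ultimately show ?thesis by (simp add: root_sum_def root_prod_def X_def Y_def Z_def)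
qed

text \<open>At t = b only the y-term of the cubic survives, so the quadratic factor is at most 0
  there: its roots are real and separated by b.\<close>

lemma roots_factor:
  assumes "p \<in> ellipsoid a b c"
  shows "t\<^sup>2 - root_sum p * t + root_prod p = (t - root_lo p) * (t - root_hi p)" and "root_lo p \<le> b" "b \<le> root_hi p"
proof -
  define D where "D = (root_sum p)\<^sup>2 - 4 * root_prod p"
  have "b * (b\<^sup>2 - root_sum p * b + root_prod p) = - ((p$2)\<^sup>2 * (a - b) * (b - c))"
    using confocal_polynomial[OF assms, of b] by (simp add: algebra_simps)
  also have "\<dots> \<le> 0" using ab bc by simp
  finally have "b\<^sup>2 - root_sum p * b + root_prod p \<le> 0"
    using bc c0 by (simp add: mult_le_0_iff)
  moreover have "D = (2 * b - root_sum p)\<^sup>2 - 4 * (b\<^sup>2 - root_sum p * b + root_prod p)"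
    by (simp add: D_def algebra_simps power2_eq_square)
  ultimately have D: "D \<ge> (2 * b - root_sum p)\<^sup>2" by simp
  then have "sqrt D \<ge> \<bar>2 * b - root_sum p\<bar>" by (simp add: real_le_rsqrt)
  then show "root_lo p \<le> b" "b \<le> root_hi p" by (auto simp: root_lo_def root_hi_def D_def)
  have "D \<ge> 0" using D by (meson order_trans zero_le_power2)
  then have "(sqrt D)\<^sup>2 = D" by simp
  then have "root_sum p = root_lo p + root_hi p" "root_prod p = root_lo p * root_hi p"
    by (simp_all add: root_lo_def root_hi_def D_def[symmetric] field_simps power2_eq_square)
      (simp add: D_def algebra_simps power2_eq_square)
  then show "t\<^sup>2 - root_sum p * t + root_prod p = (t - root_lo p) * (t - root_hi p)"
    by (simp add: algebra_simps power2_eq_square)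
qed

text \<open>Putting t = a, b, c in the cubic leaves one coordinate each time.\<close>

lemma coords_sq:
  assumes "p \<in> ellipsoid a b c"
  shows "(p$1)\<^sup>2 * ((a - b) * (a - c)) = a * ((a - root_lo p) * (a - root_hi p))"
    and "(p$2)\<^sup>2 * ((a - b) * (b - c)) = b * ((b - root_lo p) * (root_hi p - b))"
    and "(p$3)\<^sup>2 * ((a - c) * (b - c)) = c * ((root_lo p - c) * (root_hi p - c))"
  using confocal_polynomial[OF assms, of a] confocal_polynomial[OF assms, of b]
    confocal_polynomial[OF assms, of c]
  unfolding roots_factor(1)[OF assms] by (simp_all add: algebra_simps)

lemma roots_bounds:
  assumes "p \<in> ellipsoid a b c"
  shows "c \<le> root_lo p" "root_hi p \<le> a" "a - root_lo p > 0" "root_hi p - c > 0"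
proof -
  show al: "a - root_lo p > 0" and mc: "root_hi p - c > 0" using roots_factor(2,3)[OF assms] ab bc by auto
  have "0 \<le> a * ((a - root_lo p) * (a - root_hi p))" unfolding coords_sq(1)[OF assms, symmetric] using ab bc by simp
  then show "root_hi p \<le> a" using al ab bc c0 by (simp add: zero_le_mult_iff)
  have "0 \<le> c * ((root_lo p - c) * (root_hi p - c))" unfolding coords_sq(3)[OF assms, symmetric] using ab bc by simp
  then show "c \<le> root_lo p" using mc ab bc c0 by (simp add: zero_le_mult_iff)
qed

lemma confocal_quadric_iff:
  assumes "p \<in> ellipsoid a b c" "t > 0"
  shows "p \<in> confocal_quadric a b c t \<longleftrightarrow> t = root_lo p \<or> t = root_hi p"
proof -
  have "p \<in> confocal_quadric a b c t \<longleftrightarrow> - t * ((t - root_lo p) * (t - root_hi p)) = 0"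
    unfolding roots_factor(1)[OF assms(1), symmetric] confocal_polynomial[OF assms(1), symmetric]
    by (auto simp: confocal_quadric_def)
  then show ?thesis using assms(2) by simp
qed

lemma double_root_coords:
  assumes p: "p \<in> ellipsoid a b c" and eq: "root_lo p = root_hi p"
  shows "(p$1)\<^sup>2 * (a - c) = a * (a - b)" "p$2 = 0" "(p$3)\<^sup>2 * (a - c) = c * (b - c)"
proof -
  have lb: "root_lo p = b" "root_hi p = b" using roots_factor(2,3)[OF p] eq by auto
  note sq = coords_sq[OF p, unfolded lb]
  have "(a - b) * ((p$1)\<^sup>2 * (a - c)) = (a - b) * (a * (a - b))"
    using sq(1) by (simp only: mult.assoc mult.left_commute mult.commute)
  then show "(p$1)\<^sup>2 * (a - c) = a * (a - b)" using ab by simp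
  show "p$2 = 0" using sq(2) ab bc by simp
  have "(b - c) * ((p$3)\<^sup>2 * (a - c)) = (b - c) * (c * (b - c))"
    using sq(3) by (simp only: mult.assoc mult.left_commute mult.commute)
  then show "(p$3)\<^sup>2 * (a - c) = c * (b - c)" using bc by simp
qed

text \<open>A double root lies at b, where y = 0 and x^2, z^2 are known; the tangency condition then
  fixes the ratio of the squares of the first and third components of v. A region without umbilical
  points thus has no double roots.\<close>

lemma umbilicI:
  assumes p: "p \<in> ellipsoid a b c" and eq: "root_lo p = root_hi p"
  shows "p \<in> umbilics a b c"
proof -
  note x = double_root_coords(1)[OF p eq] and y = double_root_coords(2)[OF p eq]
    and z = double_root_coords(3)[OF p eq]
  \<comment> \<open>The factor has to be 1 / b: since y = 0, the direction of the second axis is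
    tangent.\<close>
  have "(v$1)\<^sup>2 / a + (v$2)\<^sup>2 / b + (v$3)\<^sup>2 / c = (1 / b) * (norm v)\<^sup>2"
    if v: "p$1 * v$1 / a + p$2 * v$2 / b + p$3 * v$3 / c = 0" for v :: "real^3"
  proof -
    have "p$1 * v$1 * c = - (p$3 * v$3 * a)" using v y ab bc c0 by (simp add: field_simps)
    then have "(p$1 * v$1 * c)\<^sup>2 = (p$3 * v$3 * a)\<^sup>2" by simp
    then have "((p$1)\<^sup>2 * (a - c)) * ((v$1)\<^sup>2 * c\<^sup>2) = ((p$3)\<^sup>2 * (a - c)) * ((v$3)\<^sup>2 * a\<^sup>2)"
      by (simp add: power_mult_distrib)
    then have "a * c * ((a - b) * (v$1)\<^sup>2 * c) = a * c * ((b - c) * (v$3)\<^sup>2 * a)"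
      unfolding x z by (simp add: power2_eq_square mult.assoc)
    then have "(a - b) * (v$1)\<^sup>2 * c = (b - c) * (v$3)\<^sup>2 * a" using ab bc c0 by simp
    then have "(v$1)\<^sup>2 / a + (v$3)\<^sup>2 / c = ((v$1)\<^sup>2 + (v$3)\<^sup>2) / b"
      using ab bc c0 by (simp add: divide_simps) (simp add: algebra_simps)
    then show ?thesis
      unfolding norm_vec_3 by (simp add: add_divide_distrib)
  qed
  then show ?thesis using p unfolding umbilics_def by blast
qed

text \<open>Finiteness permits an induction on the number of such points that a path meets.\<close>

lemma finite_double_roots: "finite {p \<in> ellipsoid a b c. root_lo p = root_hi p}"
proof -
  define X where "X = sqrt (a * (a - b) / (a - c))"
  define Z where "Z = sqrt (c * (b - c) / (a - c))"
  have "p \<in> (\<lambda>(x, z). vec3 x 0 z) ` ({X, -X} \<times> {Z, -Z})"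
    if p: "p \<in> ellipsoid a b c" and eq: "root_lo p = root_hi p" for p
  proof -
    note y = double_root_coords(2)[OF p eq]
    have "(p$1)\<^sup>2 = X\<^sup>2" "(p$3)\<^sup>2 = Z\<^sup>2"
      using double_root_coords[OF p eq] ab bc c0 by (auto simp: X_def Z_def field_simps)
    then have "p$1 \<in> {X, -X}" "p$3 \<in> {Z, -Z}" by (auto simp: power2_eq_iff)
    moreover have "p = vec3 (p$1) 0 (p$3)" using y by (simp add: vec_eq_iff forall_3)
    ultimately show ?thesis by (intro image_eqI[of _ _ "(p$1, p$3)"]) auto
  qed
  then have "{p \<in> ellipsoid a b c. root_lo p = root_hi p} \<subseteq> (\<lambda>(x, z). vec3 x 0 z) ` ({X, -X} \<times> {Z, -Z})"
    by blast
  then show ?thesis by (rule finite_subset) simp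
qed

section \<open>Angular coordinates and continuous lifts\<close>

definition sin_fst :: "real^3 \<Rightarrow> real" where "sin_fst p = p$1 / (sqrt (a / (a - c)) * sqrt (a - root_lo p))"
definition sin_snd :: "real^3 \<Rightarrow> real" where "sin_snd p = p$3 / (sqrt (c / (a - c)) * sqrt (root_hi p - c))"
text \<open>A point determines both sines but only the product of the cosines; the undetermined
  common sign is the ambiguity of the chart.\<close>

definition cos_cos :: "real^3 \<Rightarrow> real" where "cos_cos p = p$2 / sqrt b"

lemma continuous_on_sin_coords [continuous_intros]:
  fixes S :: "'x :: t2_space set"
  assumes "continuous_on S g" "g ` S \<subseteq> ellipsoid a b c"
  shows "continuous_on S (\<lambda>x. sin_fst (g x))" "continuous_on S (\<lambda>x. sin_snd (g x))" "continuous_on S (\<lambda>x. cos_cos (g x))"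
proof -
  have ne: "sqrt (a / (a - c)) * sqrt (a - root_lo (g x)) \<noteq> 0" "sqrt (c / (a - c)) * sqrt (root_hi (g x) - c) \<noteq> 0"
    if "x \<in> S" for x
    using roots_bounds(3,4)[of "g x"] assms(2) that ab bc c0 by force+
  have comp: "continuous_on S (\<lambda>x. g x $ i)" for i
    using assms(1) by (rule continuous_on_component)
  have den: "continuous_on S (\<lambda>x. sqrt (a / (a - c)) * sqrt (a - root_lo (g x)))"
    "continuous_on S (\<lambda>x. sqrt (c / (a - c)) * sqrt (root_hi (g x) - c))"
    by (intro continuous_on_mult continuous_on_const continuous_on_real_sqrt continuous_on_diff
        continuous_on_roots assms(1))+
  show "continuous_on S (\<lambda>x. sin_fst (g x))"
    unfolding sin_fst_def by (rule continuous_on_divide[OF comp den(1)]) (use ne in blast)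
  show "continuous_on S (\<lambda>x. sin_snd (g x))"
    unfolding sin_snd_def by (rule continuous_on_divide[OF comp den(2)]) (use ne in blast)
  show "continuous_on S (\<lambda>x. cos_cos (g x))"
    unfolding cos_cos_def using bc c0 by (intro continuous_on_divide[OF comp] continuous_on_const) auto
qed

lemma sin_coords_sq:
  assumes "p \<in> ellipsoid a b c"
  shows "(sin_fst p)\<^sup>2 = (a - root_hi p) / (a - b)" "(sin_snd p)\<^sup>2 = (root_lo p - c) / (b - c)"
    "(cos_cos p)\<^sup>2 = (1 - (sin_fst p)\<^sup>2) * (1 - (sin_snd p)\<^sup>2)"
    "1 - (sin_fst p)\<^sup>2 = (root_hi p - b) / (a - b)" "1 - (sin_snd p)\<^sup>2 = (b - root_lo p) / (b - c)"
proof -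
  note [simp] = power_divide power_mult_distrib
  note pos = roots_bounds[OF assms]
  have x: "(p$1)\<^sup>2 = a * ((a - root_lo p) * (a - root_hi p)) / ((a - b) * (a - c))"
    and y: "(p$2)\<^sup>2 = b * ((b - root_lo p) * (root_hi p - b)) / ((a - b) * (b - c))"
    and z: "(p$3)\<^sup>2 = c * ((root_lo p - c) * (root_hi p - c)) / ((a - c) * (b - c))"
    using coords_sq[OF assms] ab bc by (auto simp: eq_divide_eq)
  show sx: "(sin_fst p)\<^sup>2 = (a - root_hi p) / (a - b)"
    using pos ab bc c0 by (simp add: sin_fst_def x)
  show sz: "(sin_snd p)\<^sup>2 = (root_lo p - c) / (b - c)"
    using pos ab bc c0 by (simp add: sin_snd_def z)
  show 1: "1 - (sin_fst p)\<^sup>2 = (root_hi p - b) / (a - b)" unfolding sx using ab by (simp add: field_simps)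
  show 2: "1 - (sin_snd p)\<^sup>2 = (b - root_lo p) / (b - c)" unfolding sz using bc by (simp add: field_simps)
  show "(cos_cos p)\<^sup>2 = (1 - (sin_fst p)\<^sup>2) * (1 - (sin_snd p)\<^sup>2)"
    unfolding 1 2 using ab bc c0 by (simp add: cos_cos_def y)
qed

lemma sin_coords_sq_le: "p \<in> ellipsoid a b c \<Longrightarrow> (sin_fst p)\<^sup>2 \<le> 1" "p \<in> ellipsoid a b c \<Longrightarrow> (sin_snd p)\<^sup>2 \<le> 1"
  using sin_coords_sq(4,5)[of p] roots_factor(2,3)[of p] ab bc
  by (smt (verit) divide_nonneg_pos)+

lemma chart_inverse:
  assumes "p \<in> ellipsoid a b c" "sin f = sin_fst p" "sin u = sin_snd p" "cos f * cos u = cos_cos p"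
  shows "chart f u = p"
proof -
  have m: "mu f = root_hi p" and l: "la u = root_lo p"
    using sin_coords_sq(1,2)[OF assms(1)] ab bc by (auto simp: mu_def la_def assms)
  have "sin_fst p * (sqrt (a / (a - c)) * sqrt (a - root_lo p)) = p$1"
    "sin_snd p * (sqrt (c / (a - c)) * sqrt (root_hi p - c)) = p$3" "sqrt b * cos_cos p = p$2"
    using roots_bounds[OF assms(1)] ab bc c0 by (auto simp: sin_fst_def sin_snd_def cos_cos_def)
  moreover have "sqrt (a / (a - c)) * sin f * sqrt (a - la u) = sin_fst p * (sqrt (a / (a - c)) * sqrt (a - root_lo p))"
    "sqrt (c / (a - c)) * sin u * sqrt (mu f - c) = sin_snd p * (sqrt (c / (a - c)) * sqrt (root_hi p - c))"
    "sqrt b * cos f * cos u = sqrt b * cos_cos p"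
    by (simp_all add: assms(2,3) assms(4)[symmetric] m l)
  ultimately show ?thesis
    unfolding chart_def by (intro vec3_eqI[symmetric]) simp_all
qed

lemma chart_cong:
  assumes "sin f = sin f'" "sin u = sin u'" "cos f * cos u = cos f' * cos u'"
  shows "chart f u = chart f' u'"
  using assms by (simp add: chart_def mu_def la_def mult.assoc)

text \<open>The discriminant is (mu f - la u)^2, and mu f >= la u decides which root is
  which.\<close>

lemma chart_roots: "root_lo (chart f u) = la u" "root_hi (chart f u) = mu f"
proof -
  define S where "S = (sin f)\<^sup>2"
  define R where "R = (sin u)\<^sup>2"
  have C: "(cos f)\<^sup>2 = 1 - S" "(cos u)\<^sup>2 = 1 - R" by (auto simp: S_def R_def cos_squared_eq)
  have ac: "a - c \<noteq> 0" using ab bc by simp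
  have m: "mu f = a - (a - b) * S" "la u = c + (b - c) * R" by (auto simp: S_def R_def mu_def la_def)
  have sq: "(chart f u $ 1)\<^sup>2 = a / (a - c) * S * (a - la u)" "(chart f u $ 2)\<^sup>2 = b * (1 - S) * (1 - R)"
    "(chart f u $ 3)\<^sup>2 = c / (a - c) * R * (mu f - c)"
    using ab bc c0 la_bounds[of u] mu_bounds[of f]
    by (simp_all add: chart_def power_mult_distrib S_def[symmetric] R_def[symmetric] C)
  have s: "root_sum (chart f u) = mu f + la u" 
    unfolding root_sum_def sq m using ac by (simp add: divide_simps) (simp add: algebra_simps)
  have q: "root_prod (chart f u) = mu f * la u"
    unfolding root_prod_def sq m using ac by (simp add: divide_simps) (simp add: algebra_simps)
  have "(root_sum (chart f u))\<^sup>2 - 4 * root_prod (chart f u) = (mu f - la u)\<^sup>2"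
    unfolding s q by (simp add: algebra_simps power2_eq_square)
  moreover have "mu f - la u \<ge> 0" using mu_bounds[of f] la_bounds[of u] by simp
  ultimately show "root_lo (chart f u) = la u" "root_hi (chart f u) = mu f"
    unfolding root_lo_def root_hi_def s by (simp_all add: real_sqrt_abs)
qed

lemma chart_sin_coords: "sin_fst (chart f u) = sin f" "sin_snd (chart f u) = sin u" "cos_cos (chart f u) = cos f * cos u"
proof -
  have "a - la u > 0" "mu f - c > 0" using la_bounds mu_bounds by auto
  then show "sin_fst (chart f u) = sin f" "sin_snd (chart f u) = sin u" "cos_cos (chart f u) = cos f * cos u"
    using ab bc c0 by (simp_all add: sin_fst_def sin_snd_def cos_cos_def chart_roots) (simp_all add: chart_def)
qed

text \<open>Each cosine is known up to sign, and the product forces both signs to change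
  together.\<close>

lemma chart_fiber:
  assumes "chart f u = chart f' u'"
  obtains s where "s \<in> {1, -1}" "sin f' = sin f" "sin u' = sin u" "cos f' = s * cos f" "cos u' = s * cos u"
proof -
  have e: "sin f' = sin f" "sin u' = sin u" "cos f' * cos u' = cos f * cos u"
    using assms chart_sin_coords by metis+
  then have "(cos f')\<^sup>2 = (cos f)\<^sup>2" "(cos u')\<^sup>2 = (cos u)\<^sup>2" by (simp_all add: cos_squared_eq)
  then have *: "cos f' = cos f \<or> cos f' = - cos f" "cos u' = cos u \<or> cos u' = - cos u"
    by (auto simp: power2_eq_iff)
  show ?thesis
  proof (cases "cos f' = cos f \<and> cos u' = cos u")
    case True
    then show ?thesis using that[of 1] e by auto
  next
    case False
    then have "cos f' = - cos f \<and> cos u' = - cos u" using * e(3) by auto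
    then show ?thesis using that[of "-1"] e by auto
  qed
qed

text \<open>The two possible forms of \<open>f\<close> are recorded so that nearby points can be
  compared on the same branch of the arcsine.\<close>

lemma chart_surj:
  assumes "p \<in> ellipsoid a b c"
  obtains f where "chart f (arcsin (sin_snd p)) = p" "f = arcsin (sin_fst p) \<or> f = pi - arcsin (sin_fst p)"
proof -
  have r: "-1 \<le> sin_fst p" "sin_fst p \<le> 1" "-1 \<le> sin_snd p" "sin_snd p \<le> 1"
    using sin_coords_sq_le[OF assms] by (auto simp: abs_square_le_1 abs_le_iff)
  define f where "f = (if cos_cos p \<ge> 0 then arcsin (sin_fst p) else pi - arcsin (sin_fst p))"
  have "\<bar>cos_cos p\<bar> = sqrt ((cos_cos p)\<^sup>2)" by simp
  also have "\<dots> = sqrt (1 - (sin_fst p)\<^sup>2) * sqrt (1 - (sin_snd p)\<^sup>2)"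
    by (simp add: sin_coords_sq(3)[OF assms] real_sqrt_mult)
  finally have "\<bar>cos_cos p\<bar> = sqrt (1 - (sin_fst p)\<^sup>2) * sqrt (1 - (sin_snd p)\<^sup>2)" .
  then have "chart f (arcsin (sin_snd p)) = p"
    using r by (intro chart_inverse assms) (auto simp: f_def cos_arcsin abs_if split: if_splits)
  then show ?thesis using that[of f] by (simp add: f_def)
qed

text \<open>With \<open>x, y, z\<close> the functions \<open>sin_fst\<close>, \<open>cos_cos\<close>, \<open>sin_snd\<close> along \<open>k\<close>, a lift satisfies
  \<open>(cos f + \<i> cos u)\<^sup>2 = z\<^sup>2 - x\<^sup>2 + 2 \<i> y\<close>. The right-hand side vanishes only at double roots, so
  on a contractible set it has a continuous square root, whose real and imaginary parts are the
  cosines.\<close>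

lemma lift_exists:
  fixes k :: "'x::real_normed_vector \<Rightarrow> real^3"
  assumes k: "continuous_on S k" "k ` S \<subseteq> ellipsoid a b c" and S: "contractible S"
    and ne: "\<And>t. t \<in> S \<Longrightarrow> root_lo (k t) \<noteq> root_hi (k t)"
  obtains f u where "continuous_on S f" "continuous_on S u" "\<And>t. t \<in> S \<Longrightarrow> chart (f t) (u t) = k t"
proof -
  have E: "k t \<in> ellipsoid a b c" if "t \<in> S" for t using k(2) that by auto
  define w where "w = (\<lambda>t. Complex ((sin_snd (k t))\<^sup>2 - (sin_fst (k t))\<^sup>2) (2 * cos_cos (k t)))"
  have cX: "continuous_on S (\<lambda>t. sin_fst (k t))" "continuous_on S (\<lambda>t. sin_snd (k t))" "continuous_on S (\<lambda>t. cos_cos (k t))"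
    using continuous_on_sin_coords[OF k] by auto
  have cw: "continuous_on S w"
    unfolding w_def Complex_eq
    by (intro continuous_on_add continuous_on_mult continuous_on_of_real continuous_on_diff
        continuous_on_power continuous_on_const cX)
  have "w t \<noteq> 0" if t: "t \<in> S" for t
  proof
    assume "w t = 0"
    then have "(sin_snd (k t))\<^sup>2 = (sin_fst (k t))\<^sup>2" "cos_cos (k t) = 0" by (auto simp: w_def complex_eq_iff)
    \<comment> \<open>Both squared cosines are equal and have product 0, so both vanish and both
      roots equal b.\<close>
    with sin_coords_sq(3)[OF E[OF t]] have "1 - (sin_fst (k t))\<^sup>2 = 0" "1 - (sin_snd (k t))\<^sup>2 = 0" by auto
    then show False using sin_coords_sq(4,5)[OF E[OF t]] ne[OF t] ab bc by simp
  qed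
  from continuous_sqrt_on_contractible[OF cw S this] obtain g where
    g: "continuous_on S g" "\<And>t. t \<in> S \<Longrightarrow> w t = (g t)\<^sup>2" by metis
  have gC: "(Re (g t))\<^sup>2 = 1 - (sin_fst (k t))\<^sup>2 \<and> (Im (g t))\<^sup>2 = 1 - (sin_snd (k t))\<^sup>2 \<and> Re (g t) * Im (g t) = cos_cos (k t)"
    if t: "t \<in> S" for t
  proof -
    define A where "A = 1 - (sin_fst (k t))\<^sup>2"
    define B where "B = 1 - (sin_snd (k t))\<^sup>2"
    have AB: "A \<ge> 0" "B \<ge> 0" using sin_coords_sq_le[OF E[OF t]] by (auto simp: A_def B_def)
    have r: "(Re (g t))\<^sup>2 - (Im (g t))\<^sup>2 = A - B" and i: "Re (g t) * Im (g t) = cos_cos (k t)"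
      using g(2)[OF t] by (auto simp: w_def complex_eq_iff power2_eq_square A_def B_def)
    \<comment> \<open>The real part of the square gives the difference of the squared cosines; its
      modulus gives their sum, hence each of them.\<close>
    have "((Re (g t))\<^sup>2 + (Im (g t))\<^sup>2)\<^sup>2 = ((Re (g t))\<^sup>2 - (Im (g t))\<^sup>2)\<^sup>2 + 4 * (Re (g t) * Im (g t))\<^sup>2"
      by (simp add: algebra_simps power2_eq_square)
    also have "\<dots> = (A + B)\<^sup>2"
      unfolding r i sin_coords_sq(3)[OF E[OF t]] A_def[symmetric] B_def[symmetric]
      by (simp add: algebra_simps power2_eq_square)
    finally have "(Re (g t))\<^sup>2 + (Im (g t))\<^sup>2 = A + B"
      using AB by (simp add: power2_eq_iff_nonneg)
    with r i show ?thesis by (auto simp: A_def B_def)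
  qed
  \<comment> \<open>The imaginary part of a continuous logarithm is an angle with prescribed cosine
    and sine.\<close>
  have arg: "\<exists>f. continuous_on S f \<and> (\<forall>t\<in>S. cos (f t) = x t \<and> sin (f t) = y t)"
    if "continuous_on S x" "continuous_on S y" and xy: "\<And>t. t \<in> S \<Longrightarrow> (x t)\<^sup>2 + (y t)\<^sup>2 = 1"
    for x y :: "'x \<Rightarrow> real"
  proof -
    have "continuous_on S (\<lambda>t. Complex (x t) (y t))"
      unfolding Complex_eq
      by (intro continuous_on_add continuous_on_mult continuous_on_of_real continuous_on_const that)
    moreover have "Complex (x t) (y t) \<noteq> 0" if "t \<in> S" for t
      using xy[OF that] by (auto simp: complex_eq_iff)
    ultimately obtain h where h: "continuous_on S h" "\<And>t. t \<in> S \<Longrightarrow> Complex (x t) (y t) = exp (h t)"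
      by (rule continuous_logarithm_on_contractible[OF _ S]) blast+
    have "cos (Im (h t)) = x t \<and> sin (Im (h t)) = y t" if t: "t \<in> S" for t
    proof -
      have "exp (Re (h t)) = cmod (Complex (x t) (y t))"
        by (simp only: h(2)[OF t] norm_exp_eq_Re)
      also have "\<dots> = 1" using xy[OF t] by (simp add: complex_norm)
      finally have e: "exp (Re (h t)) = 1" .
      have "cos (Im (h t)) = Re (exp (h t))" "sin (Im (h t)) = Im (exp (h t))"
        by (simp_all only: Re_exp Im_exp e mult_1)
      then show ?thesis by (simp only: h(2)[OF t, symmetric] complex.sel)
    qed
    then show ?thesis using continuous_on_Im[OF h(1)] by blast
  qed
  have "continuous_on S (\<lambda>t. Re (g t))" "continuous_on S (\<lambda>t. Im (g t))"
    using g(1) by (auto intro: continuous_on_Re continuous_on_Im)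
  note c = this
  obtain f where f: "continuous_on S f" "\<And>t. t \<in> S \<Longrightarrow> cos (f t) = Re (g t) \<and> sin (f t) = sin_fst (k t)"
    using arg[OF c(1) cX(1)] gC by fastforce
  obtain u where u: "continuous_on S u" "\<And>t. t \<in> S \<Longrightarrow> cos (u t) = Im (g t) \<and> sin (u t) = sin_snd (k t)"
    using arg[OF c(2) cX(2)] gC by fastforce
  show ?thesis
    by (rule that[OF f(1) u(1)], rule chart_inverse) (use f(2) u(2) gC E in auto)
qed

section \<open>The least action between points of the ellipsoid\<close>

text \<open>The lifts of the two points are left open, as they are not unique;
  \<open>surface_action_le_lift\<close> shows that the lift of the first point may be
  prescribed.\<close>

definition surface_action_le :: "real^3 \<Rightarrow> real^3 \<Rightarrow> real \<Rightarrow> bool" where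
  "surface_action_le p q L \<longleftrightarrow> (\<exists>f u f' u'. chart f u = p \<and> chart f' u' = q \<and> action_le f u f' u' L)"

lemma action_le_mono: "action_le f u f' u' L \<Longrightarrow> L \<le> M \<Longrightarrow> action_le f u f' u' M"
  unfolding action_le_def by (meson add_right_mono order_trans)

lemma surface_action_le_mono: "surface_action_le p q L \<Longrightarrow> L \<le> M \<Longrightarrow> surface_action_le p q M"
  unfolding surface_action_le_def using action_le_mono by blast

lemma surface_action_le_sym: "surface_action_le p q L \<Longrightarrow> surface_action_le q p L"
  unfolding surface_action_le_def using action_le_sym by blast

text \<open>Two lifts of a point differ by a symmetry of the chart that preserves the action, and
  this symmetry also carries the other endpoint along.\<close>

lemma surface_action_le_lift:
  assumes "surface_action_le (chart f u) q L"
  obtains f' u' where "chart f' u' = q" "action_le f u f' u' L"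
proof -
  from assms obtain g v g' v' where *: "chart g v = chart f u" "chart g' v' = q" "action_le g v g' v' L"
    unfolding surface_action_le_def by auto
  from chart_fiber[OF *(1)] obtain s where s: "s \<in> {1, -1}" "sin f = sin g" "sin u = sin v"
    "cos f = s * cos g" "cos u = s * cos v" by metis
  obtain k where k: "f = s * g + k" "\<And>t. sin (s * t + k) = sin t" "\<And>t. cos (s * t + k) = s * cos t"
    using circle_isometry[OF s(2,4,1)] by metis
  obtain j where j: "u = s * v + j" "\<And>t. sin (s * t + j) = sin t" "\<And>t. cos (s * t + j) = s * cos t"
    using circle_isometry[OF s(3,5,1)] by metis
  have "action_le f u (s * g' + k) (s * v' + j) L"
    unfolding k(1) j(1) by (rule action_le_isometry[OF *(3) s(1) s(1)]) (simp_all add: k j)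
  moreover have "chart (s * g' + k) (s * v' + j) = q"
    unfolding *(2)[symmetric] by (rule chart_cong) (use s(1) in \<open>auto simp: k j\<close>)
  ultimately show ?thesis using that by blast
qed

lemma surface_action_le_trans:
  assumes "surface_action_le p q L" "surface_action_le q r M"
  shows "surface_action_le p r (L + M)"
proof -
  from assms(1) obtain f u f' u' where *: "chart f u = p" "chart f' u' = q" "action_le f u f' u' L"
    unfolding surface_action_le_def by blast
  from assms(2)[folded *(2)] obtain f'' u'' where "chart f'' u'' = r" "action_le f' u' f'' u'' M"
    by (rule surface_action_le_lift)
  with * action_le_trans show ?thesis unfolding surface_action_le_def by blast
qed

text \<open>After lifting, this is the reversal of the second coordinate, except that the lift of
  the second point may differ from (f', u') by the common sign of the cosines.\<close>

lemma surface_action_le_swap: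
  assumes "surface_action_le (chart f u) (chart f' u') L"
  shows "surface_action_le (chart f u') (chart f' u) L"
proof -
  from assms obtain g v where g: "chart g v = chart f' u'" "action_le f u g v L" by (rule surface_action_le_lift)
  from chart_fiber[OF g(1)[symmetric]] obtain s where s: "s \<in> {1, -1}" "sin g = sin f'" "sin v = sin u'"
    "cos g = s * cos f'" "cos v = s * cos u'" by metis
  have r: "action_le f v g u L" using g(2) by (rule action_le_swap)
  show ?thesis
  proof (cases "s = 1")
    case True
    then have "chart f v = chart f u'" "chart g u = chart f' u" using s by (auto intro!: chart_cong)
    with r show ?thesis unfolding surface_action_le_def by blast
  next
    case False
    \<comment> \<open>Replacing the second angle t by pi - t is the reflection y -> -y; applied to
      both endpoints it corrects the sign without changing the action.\<close>
    then have "chart f (-1 * v + pi) = chart f u'" "chart g (-1 * u + pi) = chart f' u"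
      using s by (auto intro!: chart_cong)
    moreover have "action_le (1 * f + 0) (-1 * v + pi) (1 * g + 0) (-1 * u + pi) L"
      by (rule action_le_isometry[OF r]) auto
    ultimately show ?thesis unfolding surface_action_le_def by (metis add_0_right mult_1)
  qed
qed

lemma surface_action_le_refl:
  assumes "p \<in> ellipsoid a b c" "e > 0"
  shows "surface_action_le p p e"
proof -
  obtain f where "chart f (arcsin (sin_snd p)) = p" by (rule chart_surj[OF assms(1)])
  moreover have "action_le f (arcsin (sin_snd p)) f (arcsin (sin_snd p)) e"
    using action_le_close[OF assms(2)] by (metis abs_zero cancel_comm_monoid_add_class.diff_cancel)
  ultimately show ?thesis unfolding surface_action_le_def by blast
qed

text \<open>The arcsine is continuous up to the ends of its interval, so the sines of a point near
  \<open>x\<close> yield angles near those of \<open>x\<close>, and \<open>action_le_close\<close>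
  applies.\<close>

lemma surface_action_le_near_double_root:
  assumes x: "x \<in> ellipsoid a b c" "root_lo x = root_hi x" and e: "e > 0"
  obtains d where "d > 0" "\<And>p. p \<in> ellipsoid a b c \<Longrightarrow> dist p x < d \<Longrightarrow> surface_action_le p x e"
proof -
  obtain r where r: "r > 0" "\<And>f p f' p'. \<bar>f' - f\<bar> < r \<Longrightarrow> \<bar>p' - p\<bar> < r \<Longrightarrow> action_le f p f' p' e"
    using action_le_close[OF e] by blast
  have lb: "root_lo x = b" "root_hi x = b" using roots_factor(2,3)[OF x(1)] x(2) by auto
  have sx: "(sin_fst x)\<^sup>2 = 1" "(sin_snd x)\<^sup>2 = 1" "cos_cos x = 0"
    using sin_coords_sq[OF x(1)] ab bc by (auto simp: lb)
  have rng: "-1 \<le> sin_fst p \<and> sin_fst p \<le> 1" "-1 \<le> sin_snd p \<and> sin_snd p \<le> 1" if "p \<in> ellipsoid a b c" for p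
    using sin_coords_sq_le[OF that] by (auto simp: abs_square_le_1 abs_le_iff)
  have "continuous_on (ellipsoid a b c) (\<lambda>p. arcsin (sin_fst p))" "continuous_on (ellipsoid a b c) (\<lambda>p. arcsin (sin_snd p))"
    using rng by (auto intro!: continuous_intros)
  with x(1) r(1) obtain d1 d2 where d: "d1 > 0" "d2 > 0"
    "\<And>p. p \<in> ellipsoid a b c \<Longrightarrow> dist p x < d1 \<Longrightarrow> dist (arcsin (sin_fst p)) (arcsin (sin_fst x)) < r"
    "\<And>p. p \<in> ellipsoid a b c \<Longrightarrow> dist p x < d2 \<Longrightarrow> dist (arcsin (sin_snd p)) (arcsin (sin_snd x)) < r"
    unfolding continuous_on_iff by metis
  show ?thesis
  proof (rule that[of "min d1 d2"])
    fix p assume p: "p \<in> ellipsoid a b c" "dist p x < min d1 d2"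
    obtain f where f: "chart f (arcsin (sin_snd p)) = p" "f = arcsin (sin_fst p) \<or> f = pi - arcsin (sin_fst p)"
      by (rule chart_surj[OF p(1)])
    \<comment> \<open>The branch follows that of \<open>f\<close>. Both branches lead to
      \<open>x\<close>, because both cosines vanish there.\<close>
    define f' where "f' = (if f = arcsin (sin_fst p) then arcsin (sin_fst x) else pi - arcsin (sin_fst x))"
    have "action_le f (arcsin (sin_snd p)) f' (arcsin (sin_snd x)) e"
      using f(2) d(3,4)[OF p(1)] p(2)
      by (intro r(2)) (auto simp: f'_def dist_real_def abs_minus_commute)
    moreover have "chart f' (arcsin (sin_snd x)) = x"
      using rng[OF x(1)] sx by (intro chart_inverse x) (auto simp: f'_def cos_arcsin)
    ultimately show "surface_action_le p x e" unfolding surface_action_le_def using f(1) by blast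
  qed (use d in auto)
qed

end

section \<open>Auxiliary facts on real functions, infima and paths\<close>

lemma continuous_square_const:
  fixes h :: "real \<Rightarrow> real"
  assumes "continuous_on {0..1} h" "\<And>s. s \<in> {0..1} \<Longrightarrow> (h s)\<^sup>2 = k"
  shows "h 0 = h 1"
proof -
  have "h s \<in> {sqrt k, - sqrt k}" if "s \<in> {0..1}" for s
    using assms(2)[OF that] real_sqrt_abs[of "h s"] by (auto simp: abs_if split: if_splits)
  then have "finite (h ` {0..1})" by (blast intro: finite_subset[of _ "{sqrt k, - sqrt k}"])
  from continuous_finite_range_constant[OF connected_Icc assms(1) this]
  show ?thesis by (auto simp: constant_on_def)
qed

text \<open>If one set is empty, so is the other, and both sides are the same default value
  \<open>Inf {}\<close>.\<close>

lemma Inf_eq_if_approx: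
  fixes A B :: "real set"
  assumes "\<And>x. x \<in> A \<Longrightarrow> 0 \<le> x" "\<And>x. x \<in> B \<Longrightarrow> 0 \<le> x"
    and "\<And>x e. x \<in> A \<Longrightarrow> e > 0 \<Longrightarrow> \<exists>y\<in>B. y \<le> x + e"
    and "\<And>x e. x \<in> B \<Longrightarrow> e > 0 \<Longrightarrow> \<exists>y\<in>A. y \<le> x + e"
  shows "Inf A = Inf B"
proof -
  have le: "Inf Y \<le> Inf X"
    if X: "X \<noteq> {}" and pos: "\<And>y. y \<in> Y \<Longrightarrow> 0 \<le> y"
      and ap: "\<And>x e. x \<in> X \<Longrightarrow> e > 0 \<Longrightarrow> \<exists>y\<in>Y. y \<le> x + e" for X Y :: "real set"
  proof (rule cInf_greatest[OF X])
    fix x assume x: "x \<in> X"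
    show "Inf Y \<le> x"
    proof (rule field_le_epsilon)
      fix e :: real assume "e > 0"
      from ap[OF x this] obtain y where "y \<in> Y" "y \<le> x + e" by blast
      moreover have "bdd_below Y" using pos by (rule bdd_belowI)
      ultimately show "Inf Y \<le> x + e" using cInf_lower order_trans by blast
    qed
  qed
  show ?thesis
  proof (cases "A = {}")
    case True
    then have "B = {}" using assms(4)[of _ 1] by fastforce
    with True show ?thesis by simp
  next
    case False
    then have "B \<noteq> {}" using assms(3)[of _ 1] by fastforce
    with False show ?thesis using le[of A B] le[of B A] assms by (intro antisym) auto
  qed
qed

text \<open>Chord at most arc length; the fundamental theorem tolerates the finitely many points
  without a derivative.\<close>

lemma valid_path_displacement:
  fixes g :: "real \<Rightarrow> real^3"
  assumes g: "valid_path g"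
    and int: "(\<lambda>t. norm (vector_derivative g (at t))) integrable_on {0..1}"
    and st: "0 \<le> s" "s \<le> t" "t \<le> 1"
  shows "norm (g t - g s) \<le> integral {s..t} (\<lambda>t. norm (vector_derivative g (at t)))"
proof -
  obtain S where S: "continuous_on {0..1} g" "finite S" "g C1_differentiable_on ({0..1} - S)"
    using g unfolding valid_path_def piecewise_C1_differentiable_on_def by blast
  have "((\<lambda>t. vector_derivative g (at t)) has_integral (g t - g s)) {s..t}"
  proof (rule fundamental_theorem_of_calculus_interior_strong[OF S(2) st(2)])
    show "continuous_on {s..t} g" using S(1) by (rule continuous_on_subset) (use st in auto)
    show "(g has_vector_derivative vector_derivative g (at x)) (at x)" if "x \<in> {s<..<t} - S" for x
    proof -
      have "g differentiable at x"
        using S(3) that st unfolding C1_differentiable_on_eq by auto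
      then show ?thesis by (simp add: vector_derivative_works)
    qed
  qed
  moreover have "(\<lambda>t. norm (vector_derivative g (at t))) integrable_on {s..t}"
    using int by (rule integrable_on_subinterval) (use st in auto)
  ultimately show ?thesis
    using integral_norm_bound_integral[of "\<lambda>t. vector_derivative g (at t)" "{s..t}" "\<lambda>t. norm (vector_derivative g (at t))"]
    by (auto simp: has_integral_integrable_integral)
qed

section \<open>Bounding the action by the length of a path\<close>

context triaxial
begin

text \<open>The increments of \<open>l\<close>, in the role of arc length, dominate the chords. The
  local bound by chords becomes a bound by increments, which add up, so interval bisection extends
  it to the whole path.\<close>

lemma surface_action_le_simple_root_path:
  fixes t1 t2 :: real
  assumes t: "t1 \<le> t2" and k: "continuous_on {t1..t2} k" "k ` {t1..t2} \<subseteq> ellipsoid a b c"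
    and ne: "\<And>t. t \<in> {t1..t2} \<Longrightarrow> root_lo (k t) \<noteq> root_hi (k t)"
    and l: "\<And>s t. t1 \<le> s \<Longrightarrow> s \<le> t \<Longrightarrow> t \<le> t2 \<Longrightarrow> norm (k t - k s) \<le> l t - l s"
    and e: "e > 0"
  shows "surface_action_le (k t1) (k t2) ((1 + e) * (l t2 - l t1))"
proof -
  have "contractible {t1..t2}" by (intro convex_imp_contractible) simp
  from lift_exists[OF k this ne] obtain f u where f: "continuous_on {t1..t2} f" and u: "continuous_on {t1..t2} u"
    and fu: "\<And>t. t \<in> {t1..t2} \<Longrightarrow> chart (f t) (u t) = k t" by metis
  have c: "continuous_on {t1..t2} (\<lambda>t. (f t, u t))" by (intro continuous_intros f u)
  \<comment> \<open>The guard is there because the local step of \<open>Bolzano\<close> also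
    concerns intervals that stick out of [t1, t2].\<close>
  define P where "P = (\<lambda>s t. t1 \<le> s \<and> t \<le> t2 \<longrightarrow> action_le (f s) (u s) (f t) (u t) ((1 + e) * (l t - l s)))"
  from t have "P t1 t2"
  proof (induction rule: Bolzano)
    case (trans x y z)
    then have "t1 \<le> x \<and> z \<le> t2 \<longrightarrow> action_le (f x) (u x) (f z) (u z) ((1 + e) * (l y - l x) + (1 + e) * (l z - l y))"
      by (auto simp: P_def intro: action_le_trans)
    then show ?case by (simp add: P_def algebra_simps)
  next
    case (local x)
    then have x: "x \<in> {t1..t2}" by simp
    have "la (u x) \<noteq> mu (f x)"
      using ne[OF x] fu[OF x] chart_roots[of "f x" "u x"] by auto
    then have "la (snd (f x, u x)) < mu (fst (f x, u x))"
      using la_bounds(1)[of "u x"] mu_bounds(1)[of "f x"] by simp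
    from action_le_local[OF this e] obtain d where d: "d > 0"
      "\<And>z z'. dist z (f x, u x) < d \<Longrightarrow> dist z' (f x, u x) < d \<Longrightarrow>
     action_le (fst z) (snd z) (fst z') (snd z')
       ((1 + e) * norm (chart (fst z') (snd z') - chart (fst z) (snd z)))" by blast
    obtain r where r: "r > 0" "\<And>y. y \<in> {t1..t2} \<Longrightarrow> dist y x < r \<Longrightarrow> dist (f y, u y) (f x, u x) < d"
      using c x d(1) unfolding continuous_on_iff by metis
    show ?case
    proof (intro exI[of _ r] conjI allI impI r(1))
      fix s t assume st: "s \<le> x \<and> x \<le> t \<and> t - s < r"
      show "P s t"
        unfolding P_def
      proof
        assume st': "t1 \<le> s \<and> t \<le> t2"
        have m: "s \<in> {t1..t2}" "t \<in> {t1..t2}" using st st' by auto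
        have "action_le (f s) (u s) (f t) (u t) ((1 + e) * norm (k t - k s))"
          using d(2)[OF r(2)[OF m(1)] r(2)[OF m(2)]] st unfolding fst_conv snd_conv fu[OF m(1)] fu[OF m(2)]
          by (simp add: dist_real_def)
        then show "action_le (f s) (u s) (f t) (u t) ((1 + e) * (l t - l s))"
          by (rule action_le_mono) (use l[of s t] st st' e in \<open>auto intro!: mult_left_mono\<close>)
      qed
    qed
  qed
  then have "action_le (f t1) (u t1) (f t2) (u t2) ((1 + e) * (l t2 - l t1))" by (simp add: P_def)
  then show ?thesis using fu[of t1] fu[of t2] t unfolding surface_action_le_def by auto
qed

text \<open>A lift of a path through an umbilical point may have infinite length in the chart, so the path
  is cut at its first and its last visit to such a point and the part in between is dropped.\<close>

lemma surface_action_le_path: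
  fixes t1 t2 :: real
  assumes k: "continuous_on {\<alpha>..\<beta>} k" "k ` {\<alpha>..\<beta>} \<subseteq> ellipsoid a b c"
    and l: "\<And>s t. \<alpha> \<le> s \<Longrightarrow> s \<le> t \<Longrightarrow> t \<le> \<beta> \<Longrightarrow> norm (k t - k s) \<le> l t - l s"
    and e: "e > 0"
    and t: "\<alpha> \<le> t1" "t1 \<le> t2" "t2 \<le> \<beta>" and "r > 0"
  shows "surface_action_le (k t1) (k t2) ((1 + e) * (l t2 - l t1) + r)"
proof -
  define U where "U = {p \<in> ellipsoid a b c. root_lo p = root_hi p}"
  have U: "finite U" unfolding U_def by (rule finite_double_roots)
  from t \<open>r > 0\<close> show ?thesis
  \<comment> \<open>The points met are counted, not the visits, of which there may be infinitely
    many. The slack \<open>r\<close> is generalised because it is divided at each cut.\<close>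
  proof (induction "card (k ` {t1..t2} \<inter> U)" arbitrary: t1 t2 r rule: less_induct)
    case less
    note t = less.prems
    have kE: "k t \<in> ellipsoid a b c" if "\<alpha> \<le> t" "t \<le> \<beta>" for t using k(2) that by auto
    have lmono: "l s \<le> l s'" if "\<alpha> \<le> s" "s \<le> s'" "s' \<le> \<beta>" for s s'
      using l[OF that] norm_ge_zero[of "k s' - k s"] by linarith
    show ?case
    proof (cases "k ` {t1..t2} \<inter> U = {}")
      case True
      have "surface_action_le (k t1) (k t2) ((1 + e) * (l t2 - l t1))"
      proof (rule surface_action_le_simple_root_path[OF t(2) _ _ _ _ e])
        show "continuous_on {t1..t2} k" using k(1) by (rule continuous_on_subset) (use t in auto)
        show "k ` {t1..t2} \<subseteq> ellipsoid a b c" using k(2) t by fastforce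
        show "root_lo (k s) \<noteq> root_hi (k s)" if "s \<in> {t1..t2}" for s
        proof
          assume "root_lo (k s) = root_hi (k s)"
          then have "k s \<in> U" using that kE[of s] t by (simp add: U_def)
          then show False using True that by blast
        qed
        show "norm (k s' - k s) \<le> l s' - l s" if "t1 \<le> s" "s \<le> s'" "s' \<le> t2" for s s'
          using l[of s s'] that t by auto
      qed
      then show ?thesis by (rule surface_action_le_mono) (use t in simp)
    next
      case False
      then obtain x where x: "x \<in> U" "x \<in> k ` {t1..t2}" by blast
      define K where "K = {s \<in> {t1..t2}. k s = x}"
      have K: "compact K"
      proof -
        have "continuous_on {t1..t2} k" using k(1) by (rule continuous_on_subset) (use t in auto)
        then have "closed K" unfolding K_def by (intro continuous_closed_preimage_constant) auto
        moreover have "bounded K" unfolding K_def by (rule bounded_subset[of "{t1..t2}"]) auto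
        ultimately show ?thesis by (simp add: compact_eq_bounded_closed)
      qed
      have K': "K \<noteq> {}" using x(2) by (auto simp: K_def)
      obtain s0 where s0: "s0 \<in> K" "\<And>s. s \<in> K \<Longrightarrow> s0 \<le> s"
        using compact_attains_inf[OF K K'] by blast
      obtain s1 where s1: "s1 \<in> K" "\<And>s. s \<in> K \<Longrightarrow> s \<le> s1"
        using compact_attains_sup[OF K K'] by blast
      have m: "t1 \<le> s0" "s0 \<le> s1" "s1 \<le> t2" "k s0 = x" "k s1 = x"
        using s0 s1 by (auto simp: K_def)
      have xE: "x \<in> ellipsoid a b c" "root_lo x = root_hi x" using x(1) by (auto simp: U_def)
      \<comment> \<open>Each side of the cut receives r / 2: r / 4 for the induction hypothesis and
        r / 4 for the jump to \<open>x\<close>.\<close>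
      have r4: "r / 4 > 0" "r / 2 > 0" using t by auto
      obtain d where d: "d > 0" "\<And>p. p \<in> ellipsoid a b c \<Longrightarrow> dist p x < d \<Longrightarrow> surface_action_le p x (r / 4)"
        using surface_action_le_near_double_root[OF xE r4(1)] by blast
      have near: "\<exists>q>0. \<forall>s\<in>{\<alpha>..\<beta>}. \<bar>s - s'\<bar> < q \<longrightarrow> surface_action_le (k s) x (r / 4)"
        if s': "s' \<in> {\<alpha>..\<beta>}" "k s' = x" for s'
      proof -
        obtain q where q: "q > 0" "\<And>s. s \<in> {\<alpha>..\<beta>} \<Longrightarrow> dist s s' < q \<Longrightarrow> dist (k s) (k s') < d"
          using k(1) s'(1) d(1) unfolding continuous_on_iff by blast
        show ?thesis
        proof (intro exI[of _ q] conjI ballI impI q(1))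
          fix s assume "s \<in> {\<alpha>..\<beta>}" "\<bar>s - s'\<bar> < q"
          then show "surface_action_le (k s) x (r / 4)"
            using d(2)[of "k s"] q(2)[of s] kE[of s] s'(2) by (simp add: dist_real_def)
        qed
      qed
      have smaller: "card (k ` {v..w} \<inter> U) < card (k ` {t1..t2} \<inter> U)"
        if "t1 \<le> v" "w \<le> t2" "\<And>s. v \<le> s \<Longrightarrow> s \<le> w \<Longrightarrow> s \<notin> K" for v w
      proof (rule psubset_card_mono)
        show "finite (k ` {t1..t2} \<inter> U)" using U by simp
        have "x \<notin> k ` {v..w}"
        proof
          assume "x \<in> k ` {v..w}"
          then obtain s where s: "s \<in> {v..w}" "k s = x" by blast
          then have "s \<in> K" using that(1,2) by (simp add: K_def)
          then show False using that(3) s(1) by simp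
        qed
        moreover have "k ` {v..w} \<subseteq> k ` {t1..t2}" using that(1,2) by (intro image_mono) auto
        ultimately show "k ` {v..w} \<inter> U \<subset> k ` {t1..t2} \<inter> U" using x by blast
      qed
      have first: "surface_action_le (k t1) x ((1 + e) * (l s0 - l t1) + r / 2)"
      proof (cases "s0 = t1")
        case True
        then show ?thesis using surface_action_le_refl[OF xE(1) r4(2)] m by simp
      next
        case False
        obtain q where q: "q > 0" "\<And>s. s \<in> {\<alpha>..\<beta>} \<Longrightarrow> \<bar>s - s0\<bar> < q \<Longrightarrow> surface_action_le (k s) x (r / 4)"
          using near[of s0] m t by auto
        \<comment> \<open>Stopping strictly before the first visit removes \<open>x\<close> from the
          set of points met, as the induction needs, while the remaining jump is still
          cheap.\<close>
        define s where "s = max t1 (s0 - q / 2)"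
        have s: "t1 \<le> s" "s < s0" "\<bar>s - s0\<bar> < q" using False m q(1) by (auto simp: s_def)
        have "surface_action_le (k t1) (k s) ((1 + e) * (l s - l t1) + r / 4)"
        proof (rule less.hyps)
          show "card (k ` {t1..s} \<inter> U) < card (k ` {t1..t2} \<inter> U)"
          proof (rule smaller)
            show "v \<notin> K" if "v \<le> s" for v using s0(2)[of v] s(2) that by auto
          qed (use s m in auto)
        qed (use s m t r4 in auto)
        from surface_action_le_trans[OF this q(2)] s m t
        have "surface_action_le (k t1) x ((1 + e) * (l s - l t1) + r / 4 + r / 4)" by simp
        moreover have "(1 + e) * (l s - l t1) \<le> (1 + e) * (l s0 - l t1)"
          using lmono[of s s0] s m t e by (intro mult_left_mono) auto
        ultimately show ?thesis by (elim surface_action_le_mono) simp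
      qed
      have last: "surface_action_le x (k t2) ((1 + e) * (l t2 - l s1) + r / 2)"
      proof (cases "s1 = t2")
        case True
        then show ?thesis using surface_action_le_refl[OF xE(1) r4(2)] m by simp
      next
        case False
        obtain q where q: "q > 0" "\<And>s. s \<in> {\<alpha>..\<beta>} \<Longrightarrow> \<bar>s - s1\<bar> < q \<Longrightarrow> surface_action_le (k s) x (r / 4)"
          using near[of s1] m t by auto
        define s where "s = min t2 (s1 + q / 2)"
        have s: "s \<le> t2" "s1 < s" "\<bar>s - s1\<bar> < q" using False m q(1) by (auto simp: s_def)
        have "surface_action_le (k s) (k t2) ((1 + e) * (l t2 - l s) + r / 4)"
        proof (rule less.hyps)
          show "card (k ` {s..t2} \<inter> U) < card (k ` {t1..t2} \<inter> U)"
          proof (rule smaller)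
            show "v \<notin> K" if "s \<le> v" for v using s1(2)[of v] s(2) that by auto
          qed (use s m in auto)
        qed (use s m t r4 in auto)
        from surface_action_le_trans[OF surface_action_le_sym[OF q(2)] this] s m t
        have "surface_action_le x (k t2) (r / 4 + ((1 + e) * (l t2 - l s) + r / 4))" by simp
        moreover have "(1 + e) * (l t2 - l s) \<le> (1 + e) * (l t2 - l s1)"
          using lmono[of s1 s] s m t e by (intro mult_left_mono) auto
        ultimately show ?thesis by (elim surface_action_le_mono) simp
      qed
      \<comment> \<open>Dropping the loop between \<open>s0\<close> and \<open>s1\<close> only
        lowers the bound, since \<open>l\<close> is increasing.\<close>
      have "(1 + e) * (l s0 - l t1) + (1 + e) * (l t2 - l s1) \<le> (1 + e) * (l t2 - l t1)"
        using lmono[of s0 s1] m t e by (simp add: distrib_left[symmetric])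
      with surface_action_le_trans[OF first last] show ?thesis by (elim surface_action_le_mono) simp
    qed
  qed
qed

section \<open>Exchanging the diagonals\<close>

definition lengths :: "real^3 \<Rightarrow> real^3 \<Rightarrow> real set" where
  "lengths p q = {L. \<exists>g. valid_path g \<and> path_image g \<subseteq> ellipsoid a b c \<and> pathstart g = p \<and> pathfinish g = q \<and>
               ((\<lambda>t. norm (vector_derivative g (at t))) has_integral L) {0..1}}"

lemma lengths_nonneg: "L \<in> lengths p q \<Longrightarrow> 0 \<le> L"
  unfolding lengths_def by (auto intro: has_integral_nonneg)

text \<open>Here \<open>l\<close> is the arc length from the start, whose increments dominate the
  chords.\<close>

lemma lengths_imp_reachE:
  assumes L: "L \<in> lengths p q" and "e > 0" "r > 0"
  shows "surface_action_le p q ((1 + e) * L + r)"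
proof -
  from L obtain g where g: "valid_path g" "path_image g \<subseteq> ellipsoid a b c" "g 0 = p" "g 1 = q"
    and I: "((\<lambda>t. norm (vector_derivative g (at t))) has_integral L) {0..1}"
    unfolding lengths_def pathstart_def pathfinish_def by blast
  let ?v = "\<lambda>t. norm (vector_derivative g (at t))"
  have int: "?v integrable_on {0..1}" using I by blast
  define l where "l = (\<lambda>t. integral {0..t} ?v)"
  have "surface_action_le (g 0) (g 1) ((1 + e) * (l 1 - l 0) + r)"
  proof (rule surface_action_le_path[where \<alpha> = 0 and \<beta> = 1])
    show "continuous_on {0..1} g"
      using g(1) by (simp add: valid_path_def piecewise_C1_differentiable_on_def)
    show "g ` {0..1} \<subseteq> ellipsoid a b c" using g(2) by (simp add: path_image_def)
    show "norm (g t - g s) \<le> l t - l s" if st: "0 \<le> s" "s \<le> t" "t \<le> 1" for s t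
    proof -
      have "?v integrable_on {0..t}" using int by (rule integrable_on_subinterval) (use st in auto)
      from Henstock_Kurzweil_Integration.integral_combine[OF st(1,2) this]
      show ?thesis using valid_path_displacement[OF g(1) int st] by (simp add: l_def)
    qed
  qed (use assms in auto)
  then show ?thesis using g I by (simp add: l_def integral_unique)
qed

lemma surface_action_le_imp_lengths:
  assumes "surface_action_le p q L" "e > 0"
  shows "\<exists>M\<in>lengths p q. M \<le> L + e"
proof -
  from assms obtain f u f' u' T A B where *: "chart f u = p" "chart f' u' = q"
    "action_path V1 W1 T f f' A" "action_path V2 W2 T u u' B" "A + B \<le> L + e"
    unfolding surface_action_le_def action_le_def by blast
  obtain g M where "valid_path g" "path_image g \<subseteq> ellipsoid a b c"
    "pathstart g = p" "pathfinish g = q"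
    "((\<lambda>t. norm (vector_derivative g (at t))) has_integral M) {0..1}" "M \<le> A + B"
    by (rule action_paths_imp_path[OF *(3,4), unfolded *(1,2)])
  with *(5) show ?thesis unfolding lengths_def by (intro bexI[of _ M]) auto
qed

lemma lengths_swap:
  assumes L: "L \<in> lengths (chart f u) (chart f' u')" and e: "e > 0"
  shows "\<exists>M\<in>lengths (chart f' u) (chart f u'). M \<le> L + e"
proof -
  have L0: "L \<ge> 0" by (rule lengths_nonneg[OF L])
  \<comment> \<open>The total loss is r L + r + r: the factor 1 + r, the slack at double roots, and
    the return from action to length.\<close>
  define r where "r = e / (L + 2)"
  have r: "r > 0" "r * (L + 2) = e" using e L0 by (auto simp: r_def)
  have "surface_action_le (chart f' u) (chart f u') ((1 + r) * L + r)"
    by (rule surface_action_le_sym[OF surface_action_le_swap[OF lengths_imp_reachE[OF L r(1) r(1)]]])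
  from surface_action_le_imp_lengths[OF this r(1)] obtain M where
    "M \<in> lengths (chart f' u) (chart f u')" "M \<le> (1 + r) * L + r + r" by blast
  moreover have "(1 + r) * L + r + r = L + e" unfolding r(2)[symmetric] by (simp add: algebra_simps)
  ultimately show ?thesis by auto
qed

text \<open>\<open>lengths_swap\<close> exchanges \<open>f\<close> with \<open>f'\<close>; as this
  exchange is an involution, it gives both inequalities.\<close>

lemma intrinsic_dist_swap:
  "intrinsic_dist (ellipsoid a b c) (chart f u) (chart f' u') =
   intrinsic_dist (ellipsoid a b c) (chart f' u) (chart f u')"
  unfolding intrinsic_dist_def lengths_def[symmetric]
  by (rule Inf_eq_if_approx) (erule lengths_nonneg | erule (1) lengths_swap)+

section \<open>Common coordinates for the vertices of a quadrilateral\<close>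

lemma curvature_line1_root:
  assumes "p \<in> curvature_line1 a b c l" "l \<in> {c..b}"
  shows "root_lo p = l"
proof -
  from assms obtain m where p: "p \<in> ellipsoid a b c" "p \<in> confocal_quadric a b c l"
    and m: "m \<in> {b..a}" "m \<noteq> l" "p \<in> confocal_quadric a b c m"
    unfolding curvature_line1_def by blast
  have "l > 0" "m > 0" using assms(2) m bc c0 by auto
  \<comment> \<open>If \<open>l\<close> were the larger root only, it would be b, and
    \<open>m\<close> would be the smaller root, at most b; being at least b it would equal
    \<open>l\<close>.\<close>
  then show ?thesis
    using confocal_quadric_iff[OF p(1)] p(2) m roots_factor(2,3)[OF p(1)] assms(2) by fastforce
qed

lemma curvature_line2_root:
  assumes "p \<in> curvature_line2 a b c m" "m \<in> {b..a}"
  shows "root_hi p = m"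
proof -
  from assms obtain l where p: "p \<in> ellipsoid a b c" "p \<in> confocal_quadric a b c m"
    and l: "l \<in> {c..b}" "l \<noteq> m" "p \<in> confocal_quadric a b c l"
    unfolding curvature_line2_def by blast
  have "l > 0" "m > 0" using assms(2) l bc c0 by auto
  then show ?thesis
    using confocal_quadric_iff[OF p(1)] p(2) l roots_factor(2,3)[OF p(1)] assms(2) by fastforce
qed

text \<open>The squared sine and cosine are determined by \<open>l\<close>, and a continuous
  function with constant square is constant.\<close>

lemma la_eq_const:
  fixes h :: "real \<Rightarrow> real"
  assumes "continuous_on {0..1} h" "\<And>s. s \<in> {0..1} \<Longrightarrow> la (h s) = l"
  shows "sin (h 0) = sin (h 1)" "cos (h 0) = cos (h 1)"
proof -
  have s: "(sin (h s))\<^sup>2 = (l - c) / (b - c)" if "s \<in> {0..1}" for s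
    using assms(2)[OF that] bc by (simp add: la_def field_simps)
  show "sin (h 0) = sin (h 1)"
    by (rule continuous_square_const[OF continuous_on_sin[OF assms(1)] s])
  show "cos (h 0) = cos (h 1)"
    by (rule continuous_square_const[OF continuous_on_cos[OF assms(1)]]) (simp add: cos_squared_eq s)
qed

lemma mu_eq_const:
  fixes h :: "real \<Rightarrow> real"
  assumes "continuous_on {0..1} h" "\<And>s. s \<in> {0..1} \<Longrightarrow> mu (h s) = m"
  shows "sin (h 0) = sin (h 1)" "cos (h 0) = cos (h 1)"
proof -
  have s: "(sin (h s))\<^sup>2 = (a - m) / (a - b)" if "s \<in> {0..1}" for s
    using assms(2)[OF that] ab by (simp add: mu_def field_simps)
  show "sin (h 0) = sin (h 1)"
    by (rule continuous_square_const[OF continuous_on_sin[OF assms(1)] s])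
  show "cos (h 0) = cos (h 1)"
    by (rule continuous_square_const[OF continuous_on_cos[OF assms(1)]]) (simp add: cos_squared_eq s)
qed

text \<open>In one continuous lift of the square, the second angle is the same at both ends of a
  side of the first family, and the first angle at both ends of a side of the second family, up to
  multiples of 2 pi.\<close>

lemma quadrilateral_vertices:
  assumes "curvature_quadrilateral a b c F"
  obtains f u f' u' where "F (0, 0) = chart f u" "F (1, 1) = chart f' u'"
    "F (1, 0) = chart f' u" "F (0, 1) = chart f u'"
proof -
  let ?Q = "{0..1} \<times> {0..1} :: (real \<times> real) set"
  have F: "continuous_on ?Q F" "F ` ?Q \<subseteq> ellipsoid a b c - umbilics a b c"
    and e1: "\<And>t. t \<in> {0, 1} \<Longrightarrow> \<exists>l\<in>{c..b}. F ` ({0..1} \<times> {t}) \<subseteq> curvature_line1 a b c l"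
    and e2: "\<And>s. s \<in> {0, 1} \<Longrightarrow> \<exists>m\<in>{b..a}. F ` ({s} \<times> {0..1}) \<subseteq> curvature_line2 a b c m"
    using assms unfolding curvature_quadrilateral_def by auto
  \<comment> \<open>The whole square is lifted: a lift along the boundary alone could return with
    both cosines negated when the curve encloses an umbilical point.\<close>
  have "contractible ?Q" by (intro convex_imp_contractible convex_Times) auto
  moreover have "F ` ?Q \<subseteq> ellipsoid a b c" using F(2) by blast
  moreover have "root_lo (F z) \<noteq> root_hi (F z)" if "z \<in> ?Q" for z
    using F(2) that umbilicI[of "F z"] by blast
  ultimately obtain f u where f: "continuous_on ?Q f" and u: "continuous_on ?Q u"
    and fu: "\<And>z. z \<in> ?Q \<Longrightarrow> chart (f z) (u z) = F z"
    using lift_exists[OF F(1)] by metis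
  have hor: "sin (u (0, t)) = sin (u (1, t)) \<and> cos (u (0, t)) = cos (u (1, t))" if t: "t \<in> {0, 1}" for t
  proof -
    obtain l where l: "l \<in> {c..b}" "F ` ({0..1} \<times> {t}) \<subseteq> curvature_line1 a b c l" using e1[OF t] by blast
    have z: "(s, t) \<in> ?Q" if "s \<in> {0..1}" for s using that t by auto
    have "la (u (s, t)) = l" if s: "s \<in> {0..1}" for s
    proof -
      have "F (s, t) \<in> curvature_line1 a b c l" using l(2) s by blast
      from curvature_line1_root[OF this l(1)] show ?thesis
        unfolding fu[OF z[OF s], symmetric] chart_roots .
    qed
    moreover have "continuous_on {0..1} (\<lambda>s. u (s, t))"
      by (rule continuous_on_compose2[OF u]) (use z in \<open>auto intro!: continuous_intros\<close>)
    ultimately show ?thesis using la_eq_const[of "\<lambda>s. u (s, t)" l] by blast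
  qed
  have ver: "sin (f (s, 0)) = sin (f (s, 1)) \<and> cos (f (s, 0)) = cos (f (s, 1))" if s: "s \<in> {0, 1}" for s
  proof -
    obtain m where m: "m \<in> {b..a}" "F ` ({s} \<times> {0..1}) \<subseteq> curvature_line2 a b c m" using e2[OF s] by blast
    have z: "(s, t) \<in> ?Q" if "t \<in> {0..1}" for t using that s by auto
    have "mu (f (s, t)) = m" if t: "t \<in> {0..1}" for t
    proof -
      have "F (s, t) \<in> curvature_line2 a b c m" using m(2) t by blast
      from curvature_line2_root[OF this m(1)] show ?thesis
        unfolding fu[OF z[OF t], symmetric] chart_roots .
    qed
    moreover have "continuous_on {0..1} (\<lambda>t. f (s, t))"
      by (rule continuous_on_compose2[OF f]) (use z in \<open>auto intro!: continuous_intros\<close>)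
    ultimately show ?thesis using mu_eq_const[of "\<lambda>t. f (s, t)" m] by blast
  qed
  show ?thesis
  \<comment> \<open>The angles at (1, 1) agree with these only modulo 2 pi, which
    \<open>chart_cong\<close> absorbs.\<close>
  proof (rule that[of "f (0, 0)" "u (0, 0)" "f (1, 0)" "u (0, 1)"])
    show "F (0, 0) = chart (f (0, 0)) (u (0, 0))" using fu[of "(0, 0)"] by simp
    show "F (1, 1) = chart (f (1, 0)) (u (0, 1))"
      using fu[of "(1, 1)"] hor[of 1] ver[of 1] by (metis chart_cong SigmaI atLeastAtMost_iff insertI1 insert_commute order_refl zero_le_one)
    show "F (1, 0) = chart (f (1, 0)) (u (0, 0))"
      using fu[of "(1, 0)"] hor[of 0] by (metis chart_cong SigmaI atLeastAtMost_iff insertI1 order_refl zero_le_one)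
    show "F (0, 1) = chart (f (0, 0)) (u (0, 1))"
      using fu[of "(0, 1)"] ver[of 0] by (metis chart_cong SigmaI atLeastAtMost_iff insertI1 order_refl zero_le_one)
  qed
qed

end

theorem theorem3:
  fixes a b c :: real and f :: "real \<times> real \<Rightarrow> real^3"
  assumes "a > b" and "b > c" and "c > 0"
    and "curvature_quadrilateral a b c f"
  shows "intrinsic_dist (ellipsoid a b c) (f (0, 0)) (f (1, 1)) =
         intrinsic_dist (ellipsoid a b c) (f (1, 0)) (f (0, 1))"
proof -
  interpret triaxial a b c by unfold_locales fact+
  from assms(4) show ?thesis
    by (rule quadrilateral_vertices) (simp only: intrinsic_dist_swap)
qed

end
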